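(* For every ordinal $\alpha$, $\mathbb{R}_\alpha$ (the set of proper elements of $\overline{\mathbb{R}}_\alpha$ with the inherited sum, product and order) is a linearly ordered field.
   Context: For an ordinal $\alpha$, let $\mathbb{N}_\alpha$ be the set of ordinals strictly less than $\omega^{\omega^\alpha}$ with the ordinal order and the natural (Hessenberg) sum and product. Let $\mathbb{Z}_\alpha$ be the classes of pairs $(a,b)\in\mathbb{N}_\alpha^2$ under $(a,b)\sim(c,d)\iff a+d=b+c$, with $(a,b)+(c,d)=(a+c,b+d)$, $(a,b)(c,d)=(ac+bd,ad+bc)$, order $[(a_1,a_2)]\ge[(b_1,b_2)]\iff a_1+b_2\ge a_2+b_1$. Let $\mathbb{Q}_\alpha$ be its field of fractions (classes of $(a,b)$, $b\ne0$, under $ad=bc$, usual fraction operations), a linearly ordered field with $A\ge0$ iff $ab\ge0$ for representatives and $A\ge B$ iff $A-B\ge0$; $\mathbb{Q}_\alpha^+$ denotes its positive elements. A Dedekind cut on $\mathbb{Q}_\alpha$ is a pair $(A,B)$ of subsets such that: every element of $A$ is less than every element of $B$; $\mathbb{Q}_\alpha\setminus(A\cup B)$ has at most one element; $\inf(B)\notin B$ and $\sup(A)\notin A$; $A\cap B=\varnothing$. $\overline{\mathbb{R}}_\alpha$ is the set of all such cuts, ordered by $(A_1,B_1)\ge(A_2,B_2)\iff A_2\subseteq A_1$. A ball in $\mathbb{Q}_\alpha$ is $\{y:|x-y|<r\}$, $x\in\mathbb{Q}_\alpha$, $r\in\mathbb{Q}_\alpha^+$; a cut $(A,B)$ is improper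 if there is $d\in\mathbb{Q}_\alpha^+$ such that every ball $U$ meeting both $A$ and $B$ has $\sup(U)-\inf(U)>d$, otherwise proper. Sum: $(A,B)+(C,D)=(A+C,B+D)$ (Minkowski sums). Opposite: $-(A,B)=(\{-y:y\in B\},\{-y:y\in A\})$; $|x|=x$ if $x\ge 0$, $-x$ if $x<0$. Product of positive cuts: $(A,B)\cdot(C,D)=(A\cdot C,B\cdot D)$ with $X\cdot Y=\{xy:x\in X,y\in Y\}$; in general, with $(E,F)=|(A,B)|\cdot|(C,D)|$, the product is $(E,F)$ if the cuts have the same sign and $-(E,F)$ otherwise. Zero cut $(\{q<0\},\{q>0\})$, unit cut $(\{q<1\},\{q>1\})$.
   Formalization: Cuts (A,B) are also required to have A closed downwards and B closed upwards (else the order is not antisymmetric), and the lower set of a product of nonnegative cuts is {q<0} together with products of nonnegative elements of A and C (the full A·C would be all of Q_α). *)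

theory Defs
  imports "HOL-Algebra.AbelCoset" "HOL-Library.Multiset"
begin

section \<open>Ordinals below \<open>\<omega>\<close> to the \<open>\<omega>\<close> to the \<open>\<alpha>\<close>\<close>

text \<open>
  An ordinal is given by a well-order \<open>r\<close> (\<^term>\<open>Well_order r\<close>; the empty relation is the ordinal 0),
  and the ordinals below it are the elements of \<^term>\<open>Field r\<close>.

  \<open>omega_exp r\<close> is the ordinal power with base \<open>\<omega>\<close> and exponent \<open>r\<close>, in the usual construction of
  ordinal exponentiation (the one of the theory Ordinal_Arithmetic of HOL-Cardinals): finitely
  supported functions, compared at the greatest argument at which they differ.
  Its element \<open>f\<close> stands for the ordinal with Cantor normal form \<open>\<Sum>x. \<omega>\<^sup>x \<cdot> f x\<close>.
\<close>

definition omega_fun :: "'a rel \<Rightarrow> ('a \<Rightarrow> nat) set" where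
  "omega_fun r = {f. finite {x. f x \<noteq> 0} \<and> {x. f x \<noteq> 0} \<subseteq> Field r}"

definition omega_exp :: "'a rel \<Rightarrow> ('a \<Rightarrow> nat) rel" where
  "omega_exp r = {(f, g). f \<in> omega_fun r \<and> g \<in> omega_fun r \<and>
     (f = g \<or> (\<exists>x\<in>Field r. f x < g x \<and> (\<forall>y. (x, y) \<in> r \<and> y \<noteq> x \<longrightarrow> f y = g y)))}"

text \<open>
  Hessenberg's operations on Cantor normal forms: the natural sum adds coefficients, and the
  natural product is the bilinear extension of \<open>\<omega>\<^sup>a \<otimes> \<omega>\<^sup>b = \<omega>\<^bsup>a \<oplus> b\<^esup>\<close>, where the exponents
  are themselves ordinals in Cantor normal form.
\<close>

definition nat_sum :: "('a \<Rightarrow> nat) \<Rightarrow> ('a \<Rightarrow> nat) \<Rightarrow> ('a \<Rightarrow> nat)" where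
  "nat_sum f g = (\<lambda>x. f x + g x)"

definition nat_prod ::
    "(('a \<Rightarrow> nat) \<Rightarrow> nat) \<Rightarrow> (('a \<Rightarrow> nat) \<Rightarrow> nat) \<Rightarrow> (('a \<Rightarrow> nat) \<Rightarrow> nat)" where
  "nat_prod f g =
     (\<lambda>c. \<Sum>(a, b) \<in> {(a, b). f a \<noteq> 0 \<and> g b \<noteq> 0 \<and> nat_sum a b = c}. f a * g b)"

abbreviation ord_zero :: "'a \<Rightarrow> nat" where
  "ord_zero \<equiv> \<lambda>_. 0"

text \<open>The ordinal \<open>\<omega>\<^sup>x\<close>.\<close>

definition omega_pow :: "'a \<Rightarrow> 'a \<Rightarrow> nat" where
  "omega_pow x = (\<lambda>y. if y = x then 1 else 0)"

abbreviation ord_one :: "('a \<Rightarrow> nat) \<Rightarrow> nat" where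
  "ord_one \<equiv> omega_pow ord_zero"

type_synonym 'a ord2 = "('a \<Rightarrow> nat) \<Rightarrow> nat"

definition N_le :: "'a rel \<Rightarrow> 'a ord2 rel" where
  "N_le \<alpha> = omega_exp (omega_exp \<alpha>)"

definition N_set :: "'a rel \<Rightarrow> 'a ord2 set" where
  "N_set \<alpha> = Field (N_le \<alpha>)"


text \<open>
  \<open>omega_exp r\<close> is again a well-order, so that it can serve as an exponent.
\<close>

lemma omega_exp_refl: "(f, f) \<in> omega_exp r \<longleftrightarrow> f \<in> omega_fun r"
  by (auto simp: omega_exp_def)

lemma Field_omega_exp: "Field (omega_exp r) = omega_fun r"
  using omega_exp_refl by (fastforce simp: Field_def omega_exp_def)

lemma omega_exp_strict:
  "(f, g) \<in> omega_exp r - Id \<longleftrightarrow> f \<in> omega_fun r \<and> g \<in> omega_fun r \<and>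
     (\<exists>x\<in>Field r. f x < g x \<and> (\<forall>y. (x, y) \<in> r \<and> y \<noteq> x \<longrightarrow> f y = g y))"
  by (auto simp: omega_exp_def)

lemma finite_has_greatest:
  assumes "Well_order r" "finite S" "S \<noteq> {}" "S \<subseteq> Field r"
  shows "\<exists>x\<in>S. \<forall>y\<in>S. (y, x) \<in> r"
  using assms(2,3,4)
proof (induction S rule: finite_ne_induct)
  case (singleton x)
  then show ?case using assms(1)
    by (auto simp: order_on_defs refl_on_def)
next
  case (insert x F)
  have tr: "trans r" and to: "total_on (Field r) r" and re: "refl_on (Field r) r"
    using assms(1) by (auto simp: order_on_defs)
  obtain m where m: "m \<in> F" "\<forall>y\<in>F. (y, m) \<in> r" using insert by auto
  have mF: "m \<in> Field r" "x \<in> Field r" using m insert by auto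
  then have "(m, x) \<in> r \<or> (x, m) \<in> r"
    using to re by (cases "m = x") (auto simp: total_on_def refl_on_def)
  then show ?case
  proof
    assume "(m, x) \<in> r"
    then have "\<forall>y\<in>insert x F. (y, x) \<in> r"
      using m(2) mF re transD[OF tr] by (auto simp: refl_on_def)
    then show ?thesis by blast
  next
    assume "(x, m) \<in> r"
    then show ?thesis using m by blast
  qed
qed

lemma greatest_difference:
  assumes "Well_order r" "f \<in> omega_fun r" "g \<in> omega_fun r" "f \<noteq> g"
  obtains x where "x \<in> Field r" "f x \<noteq> g x" "\<And>y. (x, y) \<in> r \<Longrightarrow> y \<noteq> x \<Longrightarrow> f y = g y"
proof -
  let ?S = "{x. f x \<noteq> g x}"
  have sub: "?S \<subseteq> {x. f x \<noteq> 0} \<union> {x. g x \<noteq> 0}" by auto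
  have fin: "finite ?S" and fld: "?S \<subseteq> Field r"
    using assms(2,3) sub by (auto simp: omega_fun_def intro: finite_subset[OF sub])
  have "?S \<noteq> {}" using assms(4) by auto
  from finite_has_greatest[OF assms(1) fin this fld]
  obtain x where x: "f x \<noteq> g x" "\<forall>y\<in>?S. (y, x) \<in> r" by blast
  have "antisym r" using assms(1) by (auto simp: order_on_defs)
  then have "f y = g y" if "(x, y) \<in> r" "y \<noteq> x" for y
    using that x by (auto dest: antisymD)
  with x fld show ?thesis by (intro that[of x]) auto
qed

lemma Well_order_omega_exp:
  assumes r: "Well_order r"
  shows "Well_order (omega_exp r)"
proof -
  let ?E = "omega_exp r"
  have tr: "trans r" and to: "total_on (Field r) r" and an: "antisym r" and wf: "wf (r - Id)"
    using r by (auto simp: order_on_defs)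
  have tot: "total_on (omega_fun r) ?E"
  proof (rule total_onI)
    fix f g assume fg: "f \<in> omega_fun r" "g \<in> omega_fun r" "f \<noteq> g"
    obtain x where "x \<in> Field r" "f x \<noteq> g x" "\<And>y. (x, y) \<in> r \<Longrightarrow> y \<noteq> x \<Longrightarrow> f y = g y"
      using greatest_difference[OF r fg] by blast
    then show "(f, g) \<in> ?E \<or> (g, f) \<in> ?E"
      using fg unfolding omega_exp_def by (auto simp: neq_iff)
  qed
  have strict_trans: "(f, h) \<in> ?E - Id" if "(f, g) \<in> ?E - Id" "(g, h) \<in> ?E - Id" for f g h
  proof -
    obtain x where x: "x \<in> Field r" "f x < g x" "\<forall>y. (x, y) \<in> r \<and> y \<noteq> x \<longrightarrow> f y = g y"
      using \<open>(f, g) \<in> ?E - Id\<close> unfolding omega_exp_strict by blast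
    obtain z where z: "z \<in> Field r" "g z < h z" "\<forall>y. (z, y) \<in> r \<and> y \<noteq> z \<longrightarrow> g y = h y"
      using \<open>(g, h) \<in> ?E - Id\<close> unfolding omega_exp_strict by blast
    have fh: "f \<in> omega_fun r" "h \<in> omega_fun r"
      using that by (auto simp: omega_exp_def)
    consider "x = z" | "(x, z) \<in> r" "x \<noteq> z" | "(z, x) \<in> r" "x \<noteq> z"
      using to x(1) z(1) by (auto simp: total_on_def)
    then show ?thesis
    proof cases
      case 1
      then have "f x < h x" "\<forall>y. (x, y) \<in> r \<and> y \<noteq> x \<longrightarrow> f y = h y" using x z by auto
      then show ?thesis unfolding omega_exp_strict using fh x(1) by blast
    next
      case 2
      then have "f z < h z" using x z by auto
      moreover have "f y = h y" if y: "(z, y) \<in> r" "y \<noteq> z" for y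
      proof -
        have "(x, y) \<in> r" "y \<noteq> x" using y 2 transD[OF tr] antisymD[OF an] by blast+
        then show ?thesis using x z y by simp
      qed
      ultimately show ?thesis unfolding omega_exp_strict using fh z(1) by blast
    next
      case 3
      then have "f x < h x" using x z by auto
      moreover have "f y = h y" if y: "(x, y) \<in> r" "y \<noteq> x" for y
      proof -
        have "(z, y) \<in> r" "y \<noteq> z" using y 3 transD[OF tr] antisymD[OF an] by blast+
        then show ?thesis using x z y by simp
      qed
      ultimately show ?thesis unfolding omega_exp_strict using fh x(1) by blast
    qed
  qed
  have strict_irrefl: "(f, f) \<notin> ?E - Id" for f by auto
  have trE: "trans ?E"
    by (rule transI) (use strict_trans in blast)
  have anE: "antisym ?E"
    by (rule antisymI) (use strict_trans strict_irrefl in blast)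
  have reE: "refl_on (omega_fun r) ?E" by (auto simp: refl_on_def omega_exp_refl)
  have subE: "?E \<subseteq> omega_fun r \<times> omega_fun r" by (auto simp: omega_exp_def)
  have "wf (?E - Id)"
  proof (rule wf_subset[OF wf_inv_image[OF wf_mult[OF wf], of Abs_multiset]], rule subrelI)
    fix f g assume fg: "(f, g) \<in> ?E - Id"
    obtain x where x: "x \<in> Field r" "f x < g x" "\<forall>y. (x, y) \<in> r \<and> y \<noteq> x \<longrightarrow> f y = g y"
      using fg unfolding omega_exp_strict by blast
    have fg': "f \<in> omega_fun r" "g \<in> omega_fun r"
      using fg by (auto simp: omega_exp_def)
    define M N where "M = Abs_multiset f" and "N = Abs_multiset g"
    have cM: "count M = f" and cN: "count N = g"
      using fg' by (simp_all add: M_def N_def omega_fun_def)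
    have "x \<in># N - M" using x(2) by (simp add: cM cN flip: count_greater_zero_iff)
    moreover have "(y, x) \<in> r - Id" if "y \<in># M - N" for y
    proof -
      have lt: "g y < f y" using that by (simp add: cM cN flip: count_greater_zero_iff)
      then have "y \<in> Field r" "y \<noteq> x" using fg' x(2) by (auto simp: omega_fun_def)
      moreover have "(x, y) \<notin> r" using lt x(3) \<open>y \<noteq> x\<close> by auto
      ultimately show ?thesis using to x(1) by (auto simp: total_on_def)
    qed
    ultimately have "((M \<inter># N) + (M - N), (M \<inter># N) + (N - M)) \<in> mult (r - Id)"
      by (intro one_step_implies_mult) auto
    moreover have "(M \<inter># N) + (M - N) = M" "(M \<inter># N) + (N - M) = N"
      by (auto simp: multiset_eq_iff)
    ultimately show "(f, g) \<in> inv_image (mult (r - Id)) Abs_multiset"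
      by (simp add: M_def N_def)
  qed
  with tot trE anE reE subE show ?thesis
    by (simp add: order_on_defs Field_omega_exp)
qed

text \<open>The element \<open>omega_pow x\<close> is the ordinal power with exponent the ordinal \<open>x\<close>.\<close>

lemma segment_omega_pow:
  assumes r: "Well_order r" and x: "x \<in> Field r"
  shows "Restr (omega_exp r) {f. (f, omega_pow x) \<in> omega_exp r - Id} =
    omega_exp (Restr r {y. (y, x) \<in> r - Id})"
proof -
  let ?s = "Restr r {y. (y, x) \<in> r - Id}"
  have re: "refl_on (Field r) r" and tr: "trans r" and to: "total_on (Field r) r"
    and an: "antisym r" using r by (auto simp: order_on_defs)
  have Fs: "Field ?s = {y. (y, x) \<in> r - Id}"
    using re by (fastforce simp: Field_def refl_on_def)
  have pow: "omega_pow x \<in> omega_fun r" using x by (auto simp: omega_fun_def omega_pow_def)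
  have seg: "(f, omega_pow x) \<in> omega_exp r - Id \<longleftrightarrow> f \<in> omega_fun ?s" for f
  proof
    assume "(f, omega_pow x) \<in> omega_exp r - Id"
    then obtain z where f: "f \<in> omega_fun r" and z: "f z < omega_pow x z"
      "\<forall>y. (z, y) \<in> r \<and> y \<noteq> z \<longrightarrow> f y = omega_pow x y"
      unfolding omega_exp_strict by blast
    have "z = x" "f x = 0" using z(1) by (auto simp: omega_pow_def split: if_splits)
    then have "f y = 0" if "(x, y) \<in> r" for y
      using that z(2) by (cases "y = x") (auto simp: omega_pow_def)
    then have "(y, x) \<in> r - Id" if "f y \<noteq> 0" for y
      using that f to x \<open>f x = 0\<close> by (force simp: omega_fun_def total_on_def)
    then show "f \<in> omega_fun ?s" using f unfolding omega_fun_def Fs by auto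
  next
    assume f: "f \<in> omega_fun ?s"
    then have z: "f y = 0" if "(y, x) \<notin> r - Id" for y
      using that unfolding omega_fun_def Fs by auto
    have "f \<in> omega_fun r"
      using f unfolding omega_fun_def Fs by (auto simp: Field_def)
    moreover have "f x < omega_pow x x" using z by (simp add: omega_pow_def)
    moreover have "f y = omega_pow x y" if "(x, y) \<in> r" "y \<noteq> x" for y
    proof -
      have "(y, x) \<notin> r - Id" using that an by (auto dest: antisymD)
      then show ?thesis using z that(2) by (simp add: omega_pow_def)
    qed
    ultimately show "(f, omega_pow x) \<in> omega_exp r - Id"
      using x pow unfolding omega_exp_strict by blast
  qed
  have sub: "f \<in> omega_fun r" if "f \<in> omega_fun ?s" for f
    using that unfolding omega_fun_def Fs by (auto simp: Field_def)
  have eq: "(\<exists>u\<in>Field r. f u < g u \<and> (\<forall>y. (u, y) \<in> r \<and> y \<noteq> u \<longrightarrow> f y = g y)) \<longleftrightarrow>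
      (\<exists>u\<in>Field ?s. f u < g u \<and> (\<forall>y. (u, y) \<in> ?s \<and> y \<noteq> u \<longrightarrow> f y = g y))"
    if fg: "f \<in> omega_fun ?s" "g \<in> omega_fun ?s" for f g
  proof -
    have z: "f y = 0" "g y = 0" if "(y, x) \<notin> r - Id" for y
      using that fg unfolding omega_fun_def Fs by auto
    show ?thesis
    proof
      assume "\<exists>u\<in>Field r. f u < g u \<and> (\<forall>y. (u, y) \<in> r \<and> y \<noteq> u \<longrightarrow> f y = g y)"
      then obtain u where u: "f u < g u" "\<forall>y. (u, y) \<in> r \<and> y \<noteq> u \<longrightarrow> f y = g y" by blast
      have "u \<in> Field ?s" unfolding Fs using u(1) z[of u] by (cases "(u, x) \<in> r - Id") auto
      then show "\<exists>u\<in>Field ?s. f u < g u \<and> (\<forall>y. (u, y) \<in> ?s \<and> y \<noteq> u \<longrightarrow> f y = g y)"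
        using u by blast
    next
      assume "\<exists>u\<in>Field ?s. f u < g u \<and> (\<forall>y. (u, y) \<in> ?s \<and> y \<noteq> u \<longrightarrow> f y = g y)"
      then obtain u where u: "u \<in> Field ?s" "f u < g u"
        "\<forall>y. (u, y) \<in> ?s \<and> y \<noteq> u \<longrightarrow> f y = g y" by blast
      have "f y = g y" if "(u, y) \<in> r" "y \<noteq> u" for y
      proof (cases "(y, x) \<in> r - Id")
        case True
        then show ?thesis using that u unfolding Fs by blast
      next
        case False
        then show ?thesis using z by simp
      qed
      then show "\<exists>u\<in>Field r. f u < g u \<and> (\<forall>y. (u, y) \<in> r \<and> y \<noteq> u \<longrightarrow> f y = g y)"
        using u(1,2) unfolding Fs by (auto simp: Field_def)
    qed
  qed
  have "(f, g) \<in> Restr (omega_exp r) {f. (f, omega_pow x) \<in> omega_exp r - Id} \<longleftrightarrow>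
      (f, g) \<in> omega_exp ?s" for f g
  proof -
    have "(f, g) \<in> Restr (omega_exp r) {f. (f, omega_pow x) \<in> omega_exp r - Id} \<longleftrightarrow>
        (f, g) \<in> omega_exp r \<and> f \<in> omega_fun ?s \<and> g \<in> omega_fun ?s"
      using seg[of f] seg[of g] by blast
    also have "\<dots> \<longleftrightarrow> (f, g) \<in> omega_exp ?s"
      using eq[of f g] sub unfolding omega_exp_def mem_Collect_eq prod.case by blast
    finally show ?thesis .
  qed
  then show ?thesis by (intro equalityI subrelI) blast+
qed

text \<open>
  The natural sum of \<open>f\<close> and \<open>g\<close> is the least ordinal above all natural sums in which one of the
  summands is replaced by a smaller one, so that it depends on the order only.
\<close>

lemma nat_sum_closed:
  "f \<in> omega_fun r \<Longrightarrow> g \<in> omega_fun r \<Longrightarrow> nat_sum f g \<in> omega_fun r"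
  by (auto simp: omega_fun_def nat_sum_def Collect_disj_eq)

lemma nat_sum_commute: "nat_sum f g = nat_sum g f"
  by (auto simp: nat_sum_def)

lemma nat_sum_mono:
  "(f', f) \<in> omega_exp r - Id \<Longrightarrow> g \<in> omega_fun r \<Longrightarrow>
     (nat_sum f' g, nat_sum f g) \<in> omega_exp r - Id"
  unfolding omega_exp_strict using nat_sum_closed by (fastforce simp: nat_sum_def)

lemma below_nat_sum:
  assumes r: "Well_order r" and f: "f \<in> omega_fun r" and g: "g \<in> omega_fun r"
    and h: "h \<in> omega_fun r" and x: "x \<in> Field r" "h x < nat_sum f g x" "f x > 0"
      "\<And>y. (x, y) \<in> r \<Longrightarrow> y \<noteq> x \<Longrightarrow> h y = nat_sum f g y"
  shows "\<exists>f'. (f', f) \<in> omega_exp r - Id \<and> (h, nat_sum f' g) \<in> omega_exp r"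
proof -
  define f' where "f' = (\<lambda>y. if y = x then f x - 1 else if (x, y) \<in> r then f y else h y)"
  have sub: "{y. f' y \<noteq> 0} \<subseteq> {y. f y \<noteq> 0} \<union> {y. h y \<noteq> 0}"
    by (auto simp: f'_def)
  have f': "f' \<in> omega_fun r"
    using f h sub finite_subset[OF sub] by (auto simp: omega_fun_def)
  have "f' x < f x" using x(3) by (simp add: f'_def)
  moreover have "\<forall>y. (x, y) \<in> r \<and> y \<noteq> x \<longrightarrow> f' y = f y" by (simp add: f'_def)
  ultimately have "(f', f) \<in> omega_exp r - Id"
    unfolding omega_exp_strict using f f' x(1) by blast
  moreover have "(h, nat_sum f' g) \<in> omega_exp r"
  proof (cases "h = nat_sum f' g")
    case True
    then show ?thesis using h by (simp add: omega_exp_def)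
  next
    case False
    have le: "h y \<le> nat_sum f' g y" for y
      using x(2,3) x(4)[of y] by (auto simp: f'_def nat_sum_def)
    obtain z where "z \<in> Field r" "h z \<noteq> nat_sum f' g z"
      "\<And>y. (z, y) \<in> r \<Longrightarrow> y \<noteq> z \<Longrightarrow> h y = nat_sum f' g y"
      using greatest_difference[OF r h nat_sum_closed[OF f' g] False] by blast
    with le show ?thesis
      unfolding omega_exp_def using h nat_sum_closed[OF f' g] by (auto simp: order_less_le)
  qed
  ultimately show ?thesis by blast
qed

lemma nat_sum_least:
  assumes r: "Well_order r" and f: "f \<in> omega_fun r" and g: "g \<in> omega_fun r"
    and h: "h \<in> omega_fun r"
    and up: "\<And>f'. (f', f) \<in> omega_exp r - Id \<Longrightarrow> (nat_sum f' g, h) \<in> omega_exp r - Id"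
      "\<And>g'. (g', g) \<in> omega_exp r - Id \<Longrightarrow> (nat_sum f g', h) \<in> omega_exp r - Id"
  shows "(nat_sum f g, h) \<in> omega_exp r"
proof (rule ccontr)
  assume n: "(nat_sum f g, h) \<notin> omega_exp r"
  have s: "nat_sum f g \<in> omega_fun r" using nat_sum_closed[OF f g] .
  have E: "total_on (omega_fun r) (omega_exp r)" "antisym (omega_exp r)"
    using Well_order_omega_exp[OF r] by (auto simp: order_on_defs Field_omega_exp)
  have "nat_sum f g \<noteq> h" using n s by (auto simp: omega_exp_refl)
  then have "(h, nat_sum f g) \<in> omega_exp r - Id"
    using n s h E by (auto simp: total_on_def)
  then obtain x where x: "x \<in> Field r" "h x < nat_sum f g x"
    "\<And>y. (x, y) \<in> r \<Longrightarrow> y \<noteq> x \<Longrightarrow> h y = nat_sum f g y"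
    unfolding omega_exp_strict by blast
  have "f x > 0 \<or> g x > 0" using x(2) by (auto simp: nat_sum_def)
  then show False
  proof
    assume "f x > 0"
    from below_nat_sum[OF r f g h x(1,2) this x(3)] up(1) antisymD[OF E(2)]
    show False by blast
  next
    assume "g x > 0"
    from below_nat_sum[OF r g f h x(1) _ this] x(2,3)
    obtain g' where "(g', g) \<in> omega_exp r - Id" "(h, nat_sum g' f) \<in> omega_exp r"
      by (auto simp: nat_sum_commute[of g f])
    then show False
      using up(2)[of g'] antisymD[OF E(2), of h "nat_sum g' f"] by (auto simp: nat_sum_commute)
  qed
qed

lemma nat_prod_omega_pow:
  "nat_prod (omega_pow a) (omega_pow b) = omega_pow (nat_sum a b)"
proof
  fix c
  have "{(a', b'). omega_pow a a' \<noteq> 0 \<and> omega_pow b b' \<noteq> 0 \<and> nat_sum a' b' = c} =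
      (if c = nat_sum a b then {(a, b)} else {})"
    by (auto simp: omega_pow_def split: if_splits)
  then show "nat_prod (omega_pow a) (omega_pow b) c = omega_pow (nat_sum a b) c"
    by (simp add: nat_prod_def omega_pow_def)
qed


section \<open>Ordered rings\<close>

record 'a oring = "'a ring" +
  rle :: "'a \<Rightarrow> 'a \<Rightarrow> bool" (infixl \<open>\<preceq>\<index>\<close> 50)

abbreviation rlt :: "('a, 'b) oring_scheme \<Rightarrow> 'a \<Rightarrow> 'a \<Rightarrow> bool" (infixl \<open>\<prec>\<index>\<close> 50) where
  "x \<prec>\<^bsub>F\<^esub> y \<equiv> x \<preceq>\<^bsub>F\<^esub> y \<and> x \<noteq> y"

definition linearly_ordered_field :: "('a, 'b) oring_scheme \<Rightarrow> bool" where
  "linearly_ordered_field F \<longleftrightarrow>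
     field F \<and>
     linear_order_on (carrier F) {(x, y). x \<in> carrier F \<and> y \<in> carrier F \<and> x \<preceq>\<^bsub>F\<^esub> y} \<and>
     (\<forall>x\<in>carrier F. \<forall>y\<in>carrier F. \<forall>z\<in>carrier F.
        x \<preceq>\<^bsub>F\<^esub> y \<longrightarrow> x \<oplus>\<^bsub>F\<^esub> z \<preceq>\<^bsub>F\<^esub> y \<oplus>\<^bsub>F\<^esub> z) \<and>
     (\<forall>x\<in>carrier F. \<forall>y\<in>carrier F.
        \<zero>\<^bsub>F\<^esub> \<preceq>\<^bsub>F\<^esub> x \<and> \<zero>\<^bsub>F\<^esub> \<preceq>\<^bsub>F\<^esub> y \<longrightarrow> \<zero>\<^bsub>F\<^esub> \<preceq>\<^bsub>F\<^esub> x \<otimes>\<^bsub>F\<^esub> y)"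


section \<open>The integers\<close>

type_synonym 'a oint = "('a ord2 \<times> 'a ord2) set"

definition Z_rel :: "'a rel \<Rightarrow> ('a ord2 \<times> 'a ord2) rel" where
  "Z_rel \<alpha> = {((a, b), (c, d)). a \<in> N_set \<alpha> \<and> b \<in> N_set \<alpha> \<and> c \<in> N_set \<alpha> \<and> d \<in> N_set \<alpha> \<and>
     nat_sum a d = nat_sum b c}"

definition Z_ring :: "'a rel \<Rightarrow> 'a oint oring" where
  "Z_ring \<alpha> = \<lparr>
     carrier = (N_set \<alpha> \<times> N_set \<alpha>) // Z_rel \<alpha>,
     monoid.mult = (\<lambda>X Y. \<Union>(a, b)\<in>X. \<Union>(c, d)\<in>Y.
       Z_rel \<alpha> `` {(nat_sum (nat_prod a c) (nat_prod b d), nat_sum (nat_prod a d) (nat_prod b c))}),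
     one = Z_rel \<alpha> `` {(ord_one, ord_zero)},
     zero = Z_rel \<alpha> `` {(ord_zero, ord_zero)},
     add = (\<lambda>X Y. \<Union>(a, b)\<in>X. \<Union>(c, d)\<in>Y. Z_rel \<alpha> `` {(nat_sum a c, nat_sum b d)}),
     rle = (\<lambda>Y X. \<exists>(a1, a2)\<in>X. \<exists>(b1, b2)\<in>Y. (nat_sum a2 b1, nat_sum a1 b2) \<in> N_le \<alpha>)\<rparr>"


section \<open>The field of fractions of an ordered ring\<close>

definition frac_dom :: "'a oring \<Rightarrow> ('a \<times> 'a) set" where
  "frac_dom D = carrier D \<times> (carrier D - {\<zero>\<^bsub>D\<^esub>})"

definition frac_rel :: "'a oring \<Rightarrow> ('a \<times> 'a) rel" where
  "frac_rel D = {((a, b), (c, d)). (a, b) \<in> frac_dom D \<and> (c, d) \<in> frac_dom D \<and>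
     a \<otimes>\<^bsub>D\<^esub> d = b \<otimes>\<^bsub>D\<^esub> c}"

definition frac_nonneg :: "'a oring \<Rightarrow> ('a \<times> 'a) set \<Rightarrow> bool" where
  "frac_nonneg D X \<longleftrightarrow> (\<exists>(a, b)\<in>X. \<zero>\<^bsub>D\<^esub> \<preceq>\<^bsub>D\<^esub> a \<otimes>\<^bsub>D\<^esub> b)"

definition frac_minus :: "'a oring \<Rightarrow> ('a \<times> 'a) set \<Rightarrow> ('a \<times> 'a) set \<Rightarrow> ('a \<times> 'a) set" where
  "frac_minus D X Y = (\<Union>(a, b)\<in>X. \<Union>(c, d)\<in>Y.
     frac_rel D `` {(a \<otimes>\<^bsub>D\<^esub> d \<ominus>\<^bsub>D\<^esub> b \<otimes>\<^bsub>D\<^esub> c, b \<otimes>\<^bsub>D\<^esub> d)})"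

definition frac_field :: "'a oring \<Rightarrow> ('a \<times> 'a) set oring" where
  "frac_field D = \<lparr>
     carrier = frac_dom D // frac_rel D,
     monoid.mult = (\<lambda>X Y. \<Union>(a, b)\<in>X. \<Union>(c, d)\<in>Y.
       frac_rel D `` {(a \<otimes>\<^bsub>D\<^esub> c, b \<otimes>\<^bsub>D\<^esub> d)}),
     one = frac_rel D `` {(\<one>\<^bsub>D\<^esub>, \<one>\<^bsub>D\<^esub>)},
     zero = frac_rel D `` {(\<zero>\<^bsub>D\<^esub>, \<one>\<^bsub>D\<^esub>)},
     add = (\<lambda>X Y. \<Union>(a, b)\<in>X. \<Union>(c, d)\<in>Y.
       frac_rel D `` {(a \<otimes>\<^bsub>D\<^esub> d \<oplus>\<^bsub>D\<^esub> b \<otimes>\<^bsub>D\<^esub> c, b \<otimes>\<^bsub>D\<^esub> d)}),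
     rle = (\<lambda>Y X. frac_nonneg D (frac_minus D X Y))\<rparr>"

type_synonym 'a orat = "('a oint \<times> 'a oint) set"

definition Q_field :: "'a rel \<Rightarrow> 'a orat oring" where
  "Q_field \<alpha> = frac_field (Z_ring \<alpha>)"


section \<open>Dedekind cuts\<close>

type_synonym 'q cut = "'q set \<times> 'q set"

definition is_sup :: "'q oring \<Rightarrow> 'q set \<Rightarrow> 'q \<Rightarrow> bool" where
  "is_sup F S s \<longleftrightarrow> s \<in> carrier F \<and> (\<forall>y\<in>S. y \<preceq>\<^bsub>F\<^esub> s) \<and>
     (\<forall>u\<in>carrier F. (\<forall>y\<in>S. y \<preceq>\<^bsub>F\<^esub> u) \<longrightarrow> s \<preceq>\<^bsub>F\<^esub> u)"

definition is_inf :: "'q oring \<Rightarrow> 'q set \<Rightarrow> 'q \<Rightarrow> bool" where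
  "is_inf F S s \<longleftrightarrow> s \<in> carrier F \<and> (\<forall>y\<in>S. s \<preceq>\<^bsub>F\<^esub> y) \<and>
     (\<forall>u\<in>carrier F. (\<forall>y\<in>S. u \<preceq>\<^bsub>F\<^esub> y) \<longrightarrow> u \<preceq>\<^bsub>F\<^esub> s)"

text \<open>
  The first and second component are taken to be closed downwards and upwards, as is implicit in
  the notion of a Dedekind cut: without this, one point could be deleted from a component of any
  cut that omits no point, and the order by inclusion of the first components
  would not be antisymmetric.
  A supremum or infimum need not exist; the condition on it is then void.
\<close>

definition is_cut :: "'q oring \<Rightarrow> 'q cut \<Rightarrow> bool" where
  "is_cut F = (\<lambda>(A, B).
     A \<subseteq> carrier F \<and> B \<subseteq> carrier F \<and>
     (\<forall>a\<in>A. \<forall>x\<in>carrier F. x \<preceq>\<^bsub>F\<^esub> a \<longrightarrow> x \<in> A) \<and>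
     (\<forall>b\<in>B. \<forall>x\<in>carrier F. b \<preceq>\<^bsub>F\<^esub> x \<longrightarrow> x \<in> B) \<and>
     (\<forall>a\<in>A. \<forall>b\<in>B. a \<prec>\<^bsub>F\<^esub> b) \<and>
     (\<forall>x\<in>carrier F - (A \<union> B). \<forall>y\<in>carrier F - (A \<union> B). x = y) \<and>
     (\<forall>b. is_inf F B b \<longrightarrow> b \<notin> B) \<and>
     (\<forall>a. is_sup F A a \<longrightarrow> a \<notin> A) \<and>
     A \<inter> B = {})"

definition rabs :: "'q oring \<Rightarrow> 'q \<Rightarrow> 'q" where
  "rabs F x = (if \<zero>\<^bsub>F\<^esub> \<preceq>\<^bsub>F\<^esub> x then x else \<ominus>\<^bsub>F\<^esub> x)"

definition rball :: "'q oring \<Rightarrow> 'q \<Rightarrow> 'q \<Rightarrow> 'q set" where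
  "rball F x r = {y \<in> carrier F. rabs F (x \<ominus>\<^bsub>F\<^esub> y) \<prec>\<^bsub>F\<^esub> r}"

definition improper :: "'q oring \<Rightarrow> 'q cut \<Rightarrow> bool" where
  "improper F = (\<lambda>(A, B). \<exists>d\<in>carrier F. \<zero>\<^bsub>F\<^esub> \<prec>\<^bsub>F\<^esub> d \<and>
     (\<forall>x\<in>carrier F. \<forall>r\<in>carrier F. \<zero>\<^bsub>F\<^esub> \<prec>\<^bsub>F\<^esub> r \<longrightarrow>
        (let U = rball F x r in U \<inter> A \<noteq> {} \<and> U \<inter> B \<noteq> {} \<longrightarrow>
           d \<prec>\<^bsub>F\<^esub> (THE s. is_sup F U s) \<ominus>\<^bsub>F\<^esub> (THE i. is_inf F U i))))"

definition cut_le :: "'q cut \<Rightarrow> 'q cut \<Rightarrow> bool" where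
  "cut_le c d \<longleftrightarrow> fst c \<subseteq> fst d"

definition cut_zero :: "'q oring \<Rightarrow> 'q cut" where
  "cut_zero F = ({q \<in> carrier F. q \<prec>\<^bsub>F\<^esub> \<zero>\<^bsub>F\<^esub>}, {q \<in> carrier F. \<zero>\<^bsub>F\<^esub> \<prec>\<^bsub>F\<^esub> q})"

definition cut_one :: "'q oring \<Rightarrow> 'q cut" where
  "cut_one F = ({q \<in> carrier F. q \<prec>\<^bsub>F\<^esub> \<one>\<^bsub>F\<^esub>}, {q \<in> carrier F. \<one>\<^bsub>F\<^esub> \<prec>\<^bsub>F\<^esub> q})"

definition cut_add :: "'q oring \<Rightarrow> 'q cut \<Rightarrow> 'q cut \<Rightarrow> 'q cut" where
  "cut_add F = (\<lambda>(A, B) (C, D). (A <+>\<^bsub>F\<^esub> C, B <+>\<^bsub>F\<^esub> D))"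

definition cut_uminus :: "'q oring \<Rightarrow> 'q cut \<Rightarrow> 'q cut" where
  "cut_uminus F = (\<lambda>(A, B). ((\<lambda>y. \<ominus>\<^bsub>F\<^esub> y) ` B, (\<lambda>y. \<ominus>\<^bsub>F\<^esub> y) ` A))"

definition cut_nonneg :: "'q oring \<Rightarrow> 'q cut \<Rightarrow> bool" where
  "cut_nonneg F c \<longleftrightarrow> cut_le (cut_zero F) c"

definition cut_abs :: "'q oring \<Rightarrow> 'q cut \<Rightarrow> 'q cut" where
  "cut_abs F c = (if cut_nonneg F c then c else cut_uminus F c)"

text \<open>
  The elementwise product of two lower sets is everything, because products of negative
  elements are arbitrarily large. In the lower component of a product of nonnegative cuts,
  only nonnegative elements are therefore multiplied, and the negative elements are adjoined.
\<close>

definition cut_mult_nonneg :: "'q oring \<Rightarrow> 'q cut \<Rightarrow> 'q cut \<Rightarrow> 'q cut" where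
  "cut_mult_nonneg F = (\<lambda>(A, B) (C, D).
     ({q \<in> carrier F. q \<prec>\<^bsub>F\<^esub> \<zero>\<^bsub>F\<^esub>} \<union>
        ({x \<in> A. \<zero>\<^bsub>F\<^esub> \<preceq>\<^bsub>F\<^esub> x} <#>\<^bsub>F\<^esub> {y \<in> C. \<zero>\<^bsub>F\<^esub> \<preceq>\<^bsub>F\<^esub> y}),
      B <#>\<^bsub>F\<^esub> D))"

definition cut_mult :: "'q oring \<Rightarrow> 'q cut \<Rightarrow> 'q cut \<Rightarrow> 'q cut" where
  "cut_mult F c d =
     (let e = cut_mult_nonneg F (cut_abs F c) (cut_abs F d)
      in if cut_nonneg F c \<longleftrightarrow> cut_nonneg F d then e else cut_uminus F e)"

definition proper_cuts :: "'q oring \<Rightarrow> 'q cut oring" where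
  "proper_cuts F = \<lparr>
     carrier = {c. is_cut F c \<and> \<not> improper F c},
     monoid.mult = cut_mult F,
     one = cut_one F,
     zero = cut_zero F,
     add = cut_add F,
     rle = cut_le\<rparr>"

definition R_field :: "'a rel \<Rightarrow> 'a orat cut oring" where
  "R_field \<alpha> = proper_cuts (Q_field \<alpha>)"

end

theory Submission
  imports Defs "HOL-Library.Poly_Mapping" "HOL-Library.Set_Algebras"
    "HOL-Computational_Algebra.Fraction_Field" "HOL-Algebra.QuotRing"
begin

text \<open>
  The ordinals below \<open>\<omega>\<close> to the \<open>\<omega>\<close> to the \<open>\<alpha>\<close> embed, with Hessenberg's operations, into a monoid ring
  over the integers whose exponents form a linearly ordered group; ordered by leading coefficients
  it is an ordered integral domain. Hence the classes that make up the integers and the rationals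
  are the fibers of difference and quotient maps into an ordered field, and the rationals form a
  subfield of it.

  A cut is proper iff it has lower and upper elements at arbitrarily small distance. For proper
  cuts, \<open>(A, B) \<le> (C, D)\<close> holds as soon as every element of \<open>A\<close> is less than every element of \<open>D\<close>,
  so that an identity between cuts reduces to comparing lower elements of one side with upper
  elements of the other. The signed product inherits its laws from the product of nonnegative cuts,
  every cut being nonnegative or the opposite of a nonnegative one.
\<close>

section \<open>Ordered monoid rings\<close>

text \<open>Cancellation and the absence of zero divisors would be laborious to derive from Cantor
  normal forms. In the monoid ring both come from the coefficients, because leading terms multiply.

  The arithmetic takes place in types, where the classes of ordered rings and fields supply it. The
  records of the theorem are reached through a bijection \<open>h\<close> from a subset of a type
  onto a carrier. Subsets are needed because the monoid ring contains exponents that belong to no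
  ordinal, so that the differences of ordinals form only a subring of it.

  Properness is what makes opposites work. If every upper element b and lower element a of a cut
  satisfied b - a \<ge> d for a fixed d > 0, the lower elements a - b of the sum of the cut and its
  opposite would never exceed -d, and the sum could not be the zero cut. The same closeness of the
  components lets the first component of a proper cut determine the second, and it is preserved by
  products because nonnegative elements of bounded size have products that vary little.\<close>

lemma less_poly_mapping_iff:
  "p < q \<longleftrightarrow> (\<exists>k. Poly_Mapping.lookup p k < Poly_Mapping.lookup q k \<and> (\<forall>k'<k. Poly_Mapping.lookup p k' = Poly_Mapping.lookup q k'))"
  by transfer (simp add: less_fun_def)

text \<open>The least index of the support acts as the leading exponent. Any other pair of indices
  from the supports is at least \<open>k\<close> and \<open>l\<close> with one of them strictly
  larger, so by cancellation its sum exceeds \<open>k + l\<close>; only one pair contributes there,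
  and none below. The coefficients at \<open>k\<close> and \<open>l\<close> may be zero.\<close>

lemma lookup_mult_least:
  fixes p q :: "'k::{ordered_cancel_comm_monoid_add, linorder} \<Rightarrow>\<^sub>0 'v::semiring_0"
  assumes p: "\<And>k'. k' < k \<Longrightarrow> Poly_Mapping.lookup p k' = 0" and q: "\<And>l'. l' < l \<Longrightarrow> Poly_Mapping.lookup q l' = 0"
  shows "Poly_Mapping.lookup (p * q) (k + l) = Poly_Mapping.lookup p k * Poly_Mapping.lookup q l"
    and "m < k + l \<Longrightarrow> Poly_Mapping.lookup (p * q) m = 0"
proof -
  have zero: "Poly_Mapping.lookup p a = 0 \<or> Poly_Mapping.lookup q b = 0" if "a + b < k + l" for a b
    using that p[of a] q[of b] add_mono[of k a l b] by (meson leD leI)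
  have "(\<Sum>b. Poly_Mapping.lookup q b when k + l = a + b) = (Poly_Mapping.lookup q l when a = k)"
    if "Poly_Mapping.lookup p a \<noteq> 0" for a
  proof (cases "a = k")
    case True
    then show ?thesis by (simp add: when_def)
  next
    case False
    with p that have "k < a" by (metis linorder_neqE)
    have "(Poly_Mapping.lookup q b when k + l = a + b) = 0" for b
    proof (cases "b < l")
      case False
      then have "k + l < a + b" using \<open>k < a\<close> by (simp add: add_less_le_mono)
      then show ?thesis by simp
    qed (simp add: q)
    then show ?thesis using False by simp
  qed
  then have "Poly_Mapping.lookup p a * (\<Sum>b. Poly_Mapping.lookup q b when k + l = a + b) =
      (Poly_Mapping.lookup p k * Poly_Mapping.lookup q l when a = k)" for a
    by (cases "Poly_Mapping.lookup p a = 0") (auto simp: when_def)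
  then show "Poly_Mapping.lookup (p * q) (k + l) = Poly_Mapping.lookup p k * Poly_Mapping.lookup q l"
    by (simp add: lookup_mult)
  assume m: "m < k + l"
  have "Poly_Mapping.lookup p a * (\<Sum>b. Poly_Mapping.lookup q b when m = a + b) = 0" for a
  proof (cases "Poly_Mapping.lookup p a = 0")
    case False
    then have "(Poly_Mapping.lookup q b when m = a + b) = 0" for b
      using zero[of a b] m by (auto simp: when_def)
    then show ?thesis by simp
  qed simp
  then show "Poly_Mapping.lookup (p * q) m = 0" by (simp add: lookup_mult)
qed

instantiation poly_mapping ::
  ("{ordered_cancel_comm_monoid_add, linorder}", linordered_idom) linordered_idom
begin

definition abs_poly_mapping :: "('a \<Rightarrow>\<^sub>0 'b) \<Rightarrow> 'a \<Rightarrow>\<^sub>0 'b" where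
  "abs_poly_mapping p = (if p < 0 then - p else p)"

definition sgn_poly_mapping :: "('a \<Rightarrow>\<^sub>0 'b) \<Rightarrow> 'a \<Rightarrow>\<^sub>0 'b" where
  "sgn_poly_mapping p = (if p = 0 then 0 else if 0 < p then 1 else - 1)"

instance
proof
  fix p q r :: "'a \<Rightarrow>\<^sub>0 'b"
  \<comment> \<open>An element is positive iff its leading coefficient is, and leading coefficients
    multiply. Strict monotonicity of multiplication is this fact for \<open>r\<close> and
    \<open>q - p\<close>.\<close>
  have pos: "0 < p * q" if "0 < p" "0 < q" for p q :: "'a \<Rightarrow>\<^sub>0 'b"
  proof -
    obtain k where "0 < Poly_Mapping.lookup p k" "\<And>k'. k' < k \<Longrightarrow> Poly_Mapping.lookup p k' = 0"
      using \<open>0 < p\<close> unfolding less_poly_mapping_iff by (metis lookup_zero)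
    moreover obtain l where "0 < Poly_Mapping.lookup q l" "\<And>l'. l' < l \<Longrightarrow> Poly_Mapping.lookup q l' = 0"
      using \<open>0 < q\<close> unfolding less_poly_mapping_iff by (metis lookup_zero)
    ultimately have "0 < Poly_Mapping.lookup (p * q) (k + l)" "\<forall>m<k + l. Poly_Mapping.lookup (p * q) m = 0"
      by (simp_all add: lookup_mult_least[of k p l q])
    then show ?thesis by (auto simp: less_poly_mapping_iff)
  qed
  show "p < q \<Longrightarrow> 0 < r \<Longrightarrow> r * p < r * q"
    using pos[of r "q - p"] by (simp add: right_diff_distrib)
  show "\<bar>p\<bar> = (if p < 0 then - p else p)" by (simp add: abs_poly_mapping_def)
  show "sgn p = (if p = 0 then 0 else if 0 < p then 1 else - 1)"
    by (simp add: sgn_poly_mapping_def)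
qed

end

section \<open>Cantor normal forms as elements of an ordered monoid ring\<close>

lemma Well_order_extends_linear_order:
  assumes r: "Well_order r"
  shows "\<exists>t. linear_order_on UNIV t \<and> r \<subseteq> t"
proof -
  obtain w :: "'a rel" where w: "Well_order w \<and> Field w = UNIV"
    using well_ordering by (rule exE)
  then have "well_order_on UNIV w" by (elim conjE) (erule subst)
  then have lin: "total_on UNIV w" "trans w" "antisym w" "refl_on UNIV w"
    by (simp_all add: order_on_defs)
  have rlin: "total_on (Field r) r" "trans r" "antisym r" "refl_on (Field r) r"
    using r by (simp_all add: order_on_defs)
  \<comment> \<open>\<open>Field r\<close> keeps its order and is placed below all other points,
    which are ordered by a well-order of the whole type.\<close>
  define t where "t = r \<union> {(x, y). x \<in> Field r \<and> y \<notin> Field r} \<union>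
    {(x, y). (x, y) \<in> w \<and> x \<notin> Field r \<and> y \<notin> Field r}"
  have F: "x \<in> Field r" "y \<in> Field r" if "(x, y) \<in> r" for x y using that by (auto simp: Field_def)
  have "refl_on UNIV t"
    using lin(4) rlin(4) by (auto simp: t_def refl_on_def)
  moreover have "trans t"
    by (rule transI)
      (auto simp: t_def intro: transD[OF lin(2)] transD[OF rlin(2)] dest: F)
  moreover have "antisym t"
    by (rule antisymI)
      (auto simp: t_def intro: antisymD[OF lin(3)] antisymD[OF rlin(3)] dest: F)
  moreover have "total_on UNIV t"
    using lin(1) rlin(1) unfolding t_def total_on_def by blast
  ultimately have "linear_order_on UNIV t" by (simp add: order_on_defs)
  then show ?thesis by (auto simp: t_def)
qed

text \<open>A type-class instance cannot assume that the relation inside a key is a well-order. The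
  choice therefore yields a linear order for every \<open>r\<close>, and extends \<open>r\<close>
  when it is a well-order.\<close>

definition linear_ext :: "'a rel \<Rightarrow> 'a rel" where
  "linear_ext r = (SOME t. linear_order_on UNIV t \<and> (Well_order r \<longrightarrow> r \<subseteq> t))"

lemma linear_ext: "linear_order_on UNIV (linear_ext r)" "Well_order r \<Longrightarrow> r \<subseteq> linear_ext r"
proof -
  \<comment> \<open>The empty relation supplies some linear order on the type when \<open>r\<close>
    is not a well-order.\<close>
  have "Well_order ({} :: 'a rel)" by simp
  then have "\<exists>t. linear_order_on UNIV t \<and> (Well_order r \<longrightarrow> r \<subseteq> t)"
    using Well_order_extends_linear_order[of r] Well_order_extends_linear_order[of "{} :: 'a rel"]
    by blast
  from someI_ex[OF this]
  show "linear_order_on UNIV (linear_ext r)" "Well_order r \<Longrightarrow> r \<subseteq> linear_ext r"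
    unfolding linear_ext_def by blast+
qed

lemma linear_ext_total: "(x, y) \<in> linear_ext r \<or> (y, x) \<in> linear_ext r"
  using linear_ext(1)[of r] by (cases "x = y") (auto simp: order_on_defs total_on_def refl_on_def)

lemma linear_ext_refl: "(x, x) \<in> linear_ext r"
  using linear_ext_total[of x x] by simp

lemma linear_ext_trans: "(x, y) \<in> linear_ext r \<Longrightarrow> (y, z) \<in> linear_ext r \<Longrightarrow> (x, z) \<in> linear_ext r"
  using linear_ext(1)[of r] by (auto simp: order_on_defs dest: transD)

lemma linear_ext_antisym: "(x, y) \<in> linear_ext r \<Longrightarrow> (y, x) \<in> linear_ext r \<Longrightarrow> x = y"
  using linear_ext(1)[of r] by (auto simp: order_on_defs dest: antisymD)

text \<open>
  The monoid ring needs a type of linearly ordered indices, but the order \<open>\<alpha>\<close> is a variable of the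
  theorem. The indices therefore carry their order with them: the type is the disjoint union of
  all orders on \<open>'a\<close>. Each of them is reversed, because the order of \<open>'a \<Rightarrow>\<^sub>0 'b\<close> is decided at the
  least index and that of \<open>omega_exp\<close> at the greatest.
\<close>

datatype 'a key = Key "'a rel" 'a

instantiation key :: (type) linorder
begin

text \<open>Keys with different relations are compared by an arbitrary linear order on the
  relations; \<open>linear_ext {}\<close> is one, taken at the type of relations.\<close>

definition less_eq_key :: "'a key \<Rightarrow> 'a key \<Rightarrow> bool" where
  "less_eq_key k l = (case (k, l) of (Key r x, Key s y) \<Rightarrow>
     if r = s then (y, x) \<in> linear_ext r else (r, s) \<in> linear_ext {})"

definition less_key :: "'a key \<Rightarrow> 'a key \<Rightarrow> bool" where
  "less_key k l \<longleftrightarrow> k \<le> l \<and> \<not> l \<le> k"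

instance
proof
  fix j k l :: "'a key"
  show "k < l \<longleftrightarrow> k \<le> l \<and> \<not> l \<le> k" by (rule less_key_def)
  show "k \<le> k" by (cases k) (simp add: less_eq_key_def linear_ext_refl)
  show "j \<le> k \<Longrightarrow> k \<le> l \<Longrightarrow> j \<le> l"
    by (cases j; cases k; cases l)
      (simp_all add: less_eq_key_def split: if_splits;
        blast intro: linear_ext_trans dest: linear_ext_antisym)
  show "k \<le> l \<Longrightarrow> l \<le> k \<Longrightarrow> k = l"
    by (cases k; cases l) (auto simp: less_eq_key_def split: if_splits dest: linear_ext_antisym)
  show "k \<le> l \<or> l \<le> k"
    by (cases k; cases l) (simp add: less_eq_key_def linear_ext_total)
qed

end

lemma less_Key_iff:
  assumes r: "Well_order r" and "x \<in> Field r" "y \<in> Field r"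
  shows "Key r y < Key r x \<longleftrightarrow> (x, y) \<in> r \<and> y \<noteq> x"
proof -
  have "(x, y) \<in> r \<Longrightarrow> Key r y \<le> Key r x" "(y, x) \<in> r \<Longrightarrow> Key r x \<le> Key r y"
    using linear_ext(2)[OF r] by (auto simp: less_eq_key_def)
  moreover have "(x, y) \<in> r \<or> (y, x) \<in> r"
    using r assms(2,3) by (cases "x = y") (auto simp: order_on_defs total_on_def refl_on_def)
  ultimately show ?thesis
    by (metis key.inject leD order.not_eq_order_implies_strict)
qed

text \<open>
  Exponents are negated, since the order of the monoid ring is again decided at the least index.
\<close>

definition exponent :: "'a rel \<Rightarrow> ('a \<Rightarrow> nat) \<Rightarrow> 'a key \<Rightarrow>\<^sub>0 int" where
  "exponent r e = Abs_poly_mapping (\<lambda>k. case k of Key s x \<Rightarrow> if s = r then - int (e x) else 0)"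

lemma lookup_exponent:
  assumes "e \<in> omega_fun r"
  shows "Poly_Mapping.lookup (exponent r e) (Key s x) = (if s = r then - int (e x) else 0)"
proof -
  have "{k. (case k of Key s x \<Rightarrow> if s = r then - int (e x) else 0) \<noteq> 0} \<subseteq> Key r ` {x. e x \<noteq> 0}"
    (is "?S \<subseteq> _")
  proof
    fix k assume "k \<in> ?S"
    then show "k \<in> Key r ` {x. e x \<noteq> 0}" by (cases k) (auto split: if_splits)
  qed
  then have "finite {k. (case k of Key s x \<Rightarrow> if s = r then - int (e x) else 0) \<noteq> 0}"
    by (rule finite_subset) (use assms in \<open>auto simp: omega_fun_def\<close>)
  then show ?thesis by (simp add: exponent_def)
qed

lemma key_poly_mapping_eqI:
  fixes p q :: "'a key \<Rightarrow>\<^sub>0 'b::zero"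
  assumes "\<And>s x. Poly_Mapping.lookup p (Key s x) = Poly_Mapping.lookup q (Key s x)"
  shows "p = q"
  by (rule poly_mapping_eqI) (metis assms key.exhaust)

lemma exponent_nat_sum:
  "e \<in> omega_fun r \<Longrightarrow> e' \<in> omega_fun r \<Longrightarrow> exponent r (nat_sum e e') = exponent r e + exponent r e'"
  by (rule key_poly_mapping_eqI)
    (simp add: lookup_exponent nat_sum_closed lookup_add, simp add: nat_sum_def)

lemma ord_zero_omega_fun: "ord_zero \<in> omega_fun r"
  by (simp add: omega_fun_def)

lemma exponent_zero: "exponent r ord_zero = 0"
  by (rule key_poly_mapping_eqI) (simp add: lookup_exponent ord_zero_omega_fun)

lemma inj_on_exponent: "inj_on (exponent r) (omega_fun r)"
proof (rule inj_onI, rule ext)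
  fix e e' x assume "e \<in> omega_fun r" "e' \<in> omega_fun r" "exponent r e = exponent r e'"
  then show "e x = e' x" using lookup_exponent[of e r r x] lookup_exponent[of e' r r x] by simp
qed

lemma exponent_antimono:
  assumes r: "Well_order r" and ee: "(e, e') \<in> omega_exp r - Id"
  shows "exponent r e' < exponent r e"
proof -
  obtain x where e: "e \<in> omega_fun r" "e' \<in> omega_fun r" and x: "x \<in> Field r" "e x < e' x"
    "\<And>y. (x, y) \<in> r \<Longrightarrow> y \<noteq> x \<Longrightarrow> e y = e' y"
    using ee unfolding omega_exp_strict by blast
  \<comment> \<open>\<open>linear_ext r\<close> may put points outside \<open>Field r\<close> among
    the keys below \<open>Key r x\<close>; both functions vanish at them.\<close>
  have eq: "e y = e' y" if "Key r y < Key r x" for y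
  proof (cases "y \<in> Field r")
    case True
    then show ?thesis using that x less_Key_iff[OF r x(1) True] by blast
  next
    case False
    then have "e y = 0" "e' y = 0" using e by (auto simp: omega_fun_def)
    then show ?thesis by simp
  qed
  have "Poly_Mapping.lookup (exponent r e') k = Poly_Mapping.lookup (exponent r e) k"
    if "k < Key r x" for k
    using that eq e by (cases k) (auto simp: lookup_exponent)
  moreover have "Poly_Mapping.lookup (exponent r e') (Key r x) <
      Poly_Mapping.lookup (exponent r e) (Key r x)"
    using e x by (simp add: lookup_exponent)
  ultimately show ?thesis unfolding less_poly_mapping_iff by blast
qed

section \<open>The embedding of the ordinals into the monoid ring\<close>

type_synonym 'a ord_ring = "('a key \<Rightarrow>\<^sub>0 int) \<Rightarrow>\<^sub>0 int"

text \<open>The power \<omega>^e becomes the monomial with exponent \<open>exponent r e\<close>, and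
  the multiplicities become integer coefficients.\<close>

definition cnf_embed :: "'a rel \<Rightarrow> 'a ord2 \<Rightarrow> 'a ord_ring" where
  "cnf_embed r f = (\<Sum>e\<in>{e. f e \<noteq> 0}. Poly_Mapping.single (exponent r e) (int (f e)))"

lemma N_set_eq: "N_set r = omega_fun (omega_exp r)"
  by (simp add: N_set_def N_le_def Field_omega_exp)

lemma N_setD:
  assumes "f \<in> N_set r"
  shows "finite {e. f e \<noteq> 0}" "f e \<noteq> 0 \<Longrightarrow> e \<in> omega_fun r"
  using assms by (auto simp: N_set_eq omega_fun_def Field_omega_exp)

lemma cnf_embed_eq_sum:
  assumes "finite T" "{e. f e \<noteq> 0} \<subseteq> T"
  shows "cnf_embed r f = (\<Sum>e\<in>T. Poly_Mapping.single (exponent r e) (int (f e)))"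
  unfolding cnf_embed_def by (rule sum.mono_neutral_left) (use assms in auto)

lemma lookup_cnf_embed:
  assumes f: "f \<in> N_set r" and e: "e \<in> omega_fun r"
  shows "Poly_Mapping.lookup (cnf_embed r f) (exponent r e) = int (f e)"
proof -
  have "Poly_Mapping.lookup (cnf_embed r f) (exponent r e) =
      (\<Sum>e'\<in>{e. f e \<noteq> 0}. if e' = e then int (f e') else 0)"
    unfolding cnf_embed_def lookup_sum
    by (rule sum.cong)
      (use N_setD[OF f] e inj_onD[OF inj_on_exponent] in \<open>auto simp: lookup_single when_def\<close>)
  also have "\<dots> = int (f e)" using N_setD(1)[OF f] by simp
  finally show ?thesis .
qed

lemma lookup_cnf_embed_outside:
  assumes f: "f \<in> N_set r" and "k \<notin> exponent r ` omega_fun r"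
  shows "Poly_Mapping.lookup (cnf_embed r f) k = 0"
  unfolding cnf_embed_def lookup_sum
proof (rule sum.neutral, rule ballI)
  fix e assume "e \<in> {e. f e \<noteq> 0}"
  then have "exponent r e \<noteq> k" using N_setD(2)[OF f] assms(2) by blast
  then show "Poly_Mapping.lookup (Poly_Mapping.single (exponent r e) (int (f e))) k = 0"
    by (simp add: lookup_single)
qed

text \<open>Since \<open>exponent\<close> reverses the order, the greatest exponent at which two
  normal forms differ gives the least index at which their images differ. Indices that are not
  exponents carry the coefficient 0 on both sides.\<close>

lemma cnf_embed_strict_mono:
  assumes r: "Well_order r" and fg: "(f, g) \<in> N_le r - Id"
  shows "cnf_embed r f < cnf_embed r g"
proof -
  obtain e where N: "f \<in> N_set r" "g \<in> N_set r" and e: "e \<in> omega_fun r" "f e < g e"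
    "\<And>e'. (e, e') \<in> omega_exp r \<Longrightarrow> e' \<noteq> e \<Longrightarrow> f e' = g e'"
    using fg unfolding N_le_def omega_exp_strict N_set_eq Field_omega_exp by blast
  have "Poly_Mapping.lookup (cnf_embed r f) k = Poly_Mapping.lookup (cnf_embed r g) k"
    if k: "k < exponent r e" for k
  proof (cases "k \<in> exponent r ` omega_fun r")
    case True
    then obtain e' where e': "k = exponent r e'" "e' \<in> omega_fun r" by blast
    have "(e', e) \<notin> omega_exp r - Id" using exponent_antimono[OF r, of e' e] k e'(1) less_asym by metis
    moreover have "e' \<noteq> e" using k e' by auto
    moreover have "total_on (omega_fun r) (omega_exp r)"
      using Well_order_omega_exp[OF r] by (auto simp: order_on_defs Field_omega_exp)
    ultimately have "(e, e') \<in> omega_exp r" using e e' by (auto simp: total_on_def)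
    then show ?thesis using e(3) \<open>e' \<noteq> e\<close> e' N by (simp add: lookup_cnf_embed)
  qed (use N in \<open>simp add: lookup_cnf_embed_outside\<close>)
  moreover have "Poly_Mapping.lookup (cnf_embed r f) (exponent r e) <
      Poly_Mapping.lookup (cnf_embed r g) (exponent r e)"
    using N e by (simp add: lookup_cnf_embed)
  ultimately show ?thesis unfolding less_poly_mapping_iff by blast
qed

lemma cnf_embed_le_iff:
  assumes r: "Well_order r" and f: "f \<in> N_set r" and g: "g \<in> N_set r"
  shows "cnf_embed r f \<le> cnf_embed r g \<longleftrightarrow> (f, g) \<in> N_le r"
proof -
  have "Well_order (N_le r)"
    using r by (simp add: N_le_def Well_order_omega_exp)
  then have "total_on (N_set r) (N_le r)" "refl_on (N_set r) (N_le r)"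
    by (auto simp: order_on_defs N_set_def)
  then have "(f, g) \<in> N_le r \<or> (g, f) \<in> N_le r - Id"
    using f g by (cases "f = g") (auto simp: total_on_def refl_on_def)
  then show ?thesis
    using cnf_embed_strict_mono[OF r, of f g] cnf_embed_strict_mono[OF r, of g f] by (cases "f = g") auto
qed

lemma inj_on_cnf_embed: "Well_order r \<Longrightarrow> inj_on (cnf_embed r) (N_set r)"
proof (rule inj_onI, rule ccontr)
  fix f g assume "Well_order r" "f \<in> N_set r" "g \<in> N_set r" "cnf_embed r f = cnf_embed r g" "f \<noteq> g"
  then show False
    using cnf_embed_le_iff[of r f g] cnf_embed_strict_mono[of r f g] by simp
qed

lemma cnf_embed_nat_sum:
  assumes "f \<in> N_set r" "g \<in> N_set r"
  shows "cnf_embed r (nat_sum f g) = cnf_embed r f + cnf_embed r g"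
proof -
  let ?T = "{e. f e \<noteq> 0} \<union> {e. g e \<noteq> 0}"
  have fin: "finite ?T" using assms N_setD(1) by blast
  have "cnf_embed r h = (\<Sum>e\<in>?T. Poly_Mapping.single (exponent r e) (int (h e)))"
    if "h \<in> {f, g, nat_sum f g}" for h
    by (rule cnf_embed_eq_sum[OF fin]) (use that in \<open>auto simp: nat_sum_def\<close>)
  then show ?thesis
    by (simp add: sum.distrib[symmetric] single_add[symmetric], simp add: nat_sum_def)
qed

lemma cnf_embed_zero: "cnf_embed r ord_zero = 0"
  by (simp add: cnf_embed_def)

lemma cnf_embed_one: "cnf_embed r ord_one = 1" for r :: "'a rel"
proof -
  have "{e. (ord_one :: 'a ord2) e \<noteq> 0} = {ord_zero}" by (auto simp: omega_pow_def)
  then show ?thesis by (simp add: cnf_embed_def omega_pow_def exponent_zero)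
qed

lemma zero_N_set: "ord_zero \<in> N_set r" and one_N_set: "ord_one \<in> N_set r"
  for r :: "'a rel"
proof -
  show "ord_zero \<in> N_set r" by (simp add: N_set_eq ord_zero_omega_fun)
  have "{e. (ord_one :: 'a ord2) e \<noteq> 0} = {ord_zero}" by (auto simp: omega_pow_def)
  then show "ord_one \<in> N_set r"
    by (simp add: N_set_eq omega_fun_def[of "omega_exp r"] Field_omega_exp ord_zero_omega_fun
        del: neq0_conv)
qed

lemma nat_sum_N_set: "f \<in> N_set r \<Longrightarrow> g \<in> N_set r \<Longrightarrow> nat_sum f g \<in> N_set r"
  by (simp add: N_set_eq nat_sum_closed)

lemma nat_prod_support:
  assumes "f \<in> N_set r" "g \<in> N_set r"
  shows "{c. nat_prod f g c \<noteq> 0} \<subseteq> (\<lambda>(a, b). nat_sum a b) ` ({e. f e \<noteq> 0} \<times> {e. g e \<noteq> 0})"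
proof
  fix c assume "c \<in> {c. nat_prod f g c \<noteq> 0}"
  then have "\<exists>p\<in>{(a, b). f a \<noteq> 0 \<and> g b \<noteq> 0 \<and> nat_sum a b = c}. (case p of (a, b) \<Rightarrow> f a * g b) \<noteq> 0"
    unfolding nat_prod_def by (metis (mono_tags, lifting) mem_Collect_eq sum.not_neutral_contains_not_neutral)
  then show "c \<in> (\<lambda>(a, b). nat_sum a b) ` ({e. f e \<noteq> 0} \<times> {e. g e \<noteq> 0})" by force
qed

lemma nat_prod_N_set:
  assumes f: "f \<in> N_set r" and g: "g \<in> N_set r"
  shows "nat_prod f g \<in> N_set r"
proof -
  have "finite ((\<lambda>(a, b). nat_sum a b) ` ({e. f e \<noteq> 0} \<times> {e. g e \<noteq> 0}))"
    using N_setD(1) f g by blast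
  moreover have "(\<lambda>(a, b). nat_sum a b) ` ({e. f e \<noteq> 0} \<times> {e. g e \<noteq> 0}) \<subseteq> omega_fun r"
    using N_setD(2)[OF f] N_setD(2)[OF g] nat_sum_closed by fastforce
  ultimately show ?thesis
    using finite_subset[OF nat_prod_support[OF f g]] order_trans[OF nat_prod_support[OF f g]]
    unfolding N_set_eq omega_fun_def[of "omega_exp r"] Field_omega_exp mem_Collect_eq by metis
qed

lemma single_sum:
  "Poly_Mapping.single k (sum f A) = (\<Sum>a\<in>A. Poly_Mapping.single k (f a))"
  by (induction A rule: infinite_finite_induct) (simp_all add: single_add)

text \<open>The product of two sums of monomials is a double sum. Grouping its terms by the natural
  sum of their exponents collects exactly the coefficients of \<open>nat_prod\<close>.\<close>

lemma cnf_embed_nat_prod: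
  assumes f: "f \<in> N_set r" and g: "g \<in> N_set r"
  shows "cnf_embed r (nat_prod f g) = cnf_embed r f * cnf_embed r g"
proof -
  let ?P = "{e. f e \<noteq> 0} \<times> {e. g e \<noteq> 0}"
  let ?s = "\<lambda>(a, b). nat_sum a b"
  have fin: "finite ?P" using N_setD(1) f g by blast
  have "cnf_embed r f * cnf_embed r g =
      (\<Sum>(a, b)\<in>?P. Poly_Mapping.single (exponent r a) (int (f a)) * Poly_Mapping.single (exponent r b) (int (g b)))"
    unfolding cnf_embed_def sum_product sum.cartesian_product ..
  also have "\<dots> = (\<Sum>p\<in>?P. Poly_Mapping.single (exponent r (?s p)) (case p of (a, b) \<Rightarrow> int (f a * g b)))"
    by (rule sum.cong)
      (use N_setD(2)[OF f] N_setD(2)[OF g] in \<open>auto simp: mult_single exponent_nat_sum\<close>)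
  also have "\<dots> = (\<Sum>c\<in>?s ` ?P. \<Sum>p\<in>{p \<in> ?P. ?s p = c}.
      Poly_Mapping.single (exponent r (?s p)) (case p of (a, b) \<Rightarrow> int (f a * g b)))"
    by (rule sum.image_gen[OF fin])
  also have "\<dots> = (\<Sum>c\<in>?s ` ?P. Poly_Mapping.single (exponent r c) (int (nat_prod f g c)))"
  proof (rule sum.cong[OF refl])
    fix c
    have "{p \<in> ?P. ?s p = c} = {(a, b). f a \<noteq> 0 \<and> g b \<noteq> 0 \<and> nat_sum a b = c}" by auto
    then have "int (nat_prod f g c) = (\<Sum>p\<in>{p \<in> ?P. ?s p = c}. case p of (a, b) \<Rightarrow> int (f a * g b))"
      by (simp add: nat_prod_def case_prod_unfold)
    then show "(\<Sum>p\<in>{p \<in> ?P. ?s p = c}.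
        Poly_Mapping.single (exponent r (?s p)) (case p of (a, b) \<Rightarrow> int (f a * g b))) =
        Poly_Mapping.single (exponent r c) (int (nat_prod f g c))"
      by (simp add: single_sum)
  qed
  also have "\<dots> = cnf_embed r (nat_prod f g)"
    by (rule cnf_embed_eq_sum[symmetric]) (use fin nat_prod_support[OF f g] in auto)
  finally show ?thesis ..
qed

section \<open>Ordered rings represented by subrings of a type\<close>

text \<open>The set \<open>D\<close> names the elements of the carrier, so that laws in
  \<open>R\<close> are read off from laws in an ordered domain. Integers and rationals are both
  treated as instances, with \<open>h\<close> sending an element to its class of
  representatives.\<close>

locale subring_iso =
  fixes D :: "'u::linordered_idom set" and h :: "'u \<Rightarrow> 'r" and R :: "'r oring"
  assumes inj_h: "inj_on h D"
    and carrier_R: "carrier R = h ` D"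
    and zero_D: "0 \<in> D" and one_D: "1 \<in> D"
    and add_D: "u \<in> D \<Longrightarrow> v \<in> D \<Longrightarrow> u + v \<in> D"
    and uminus_D: "u \<in> D \<Longrightarrow> - u \<in> D"
    and mult_D: "u \<in> D \<Longrightarrow> v \<in> D \<Longrightarrow> u * v \<in> D"
    and zero_R: "\<zero>\<^bsub>R\<^esub> = h 0" and one_R: "\<one>\<^bsub>R\<^esub> = h 1"
    and add_R: "u \<in> D \<Longrightarrow> v \<in> D \<Longrightarrow> h u \<oplus>\<^bsub>R\<^esub> h v = h (u + v)"
    and mult_R: "u \<in> D \<Longrightarrow> v \<in> D \<Longrightarrow> h u \<otimes>\<^bsub>R\<^esub> h v = h (u * v)"
    and le_R: "u \<in> D \<Longrightarrow> v \<in> D \<Longrightarrow> h u \<preceq>\<^bsub>R\<^esub> h v \<longleftrightarrow> u \<le> v"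
begin

lemma diff_D: "u \<in> D \<Longrightarrow> v \<in> D \<Longrightarrow> u - v \<in> D"
  using add_D[of u "- v"] uminus_D by simp

lemma eq_iff: "u \<in> D \<Longrightarrow> v \<in> D \<Longrightarrow> h u = h v \<longleftrightarrow> u = v"
  using inj_h by (auto dest: inj_onD)

lemma abelian_group_R: "abelian_group R"
proof (rule abelian_groupI)
  fix x assume "x \<in> carrier R"
  then obtain u where "u \<in> D" "x = h u" by (auto simp: carrier_R)
  then have "h (- u) \<in> carrier R" "h (- u) \<oplus>\<^bsub>R\<^esub> x = \<zero>\<^bsub>R\<^esub>"
    by (simp_all add: carrier_R uminus_D add_R zero_R)
  then show "\<exists>y\<in>carrier R. y \<oplus>\<^bsub>R\<^esub> x = \<zero>\<^bsub>R\<^esub>" by blast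
qed (auto simp: carrier_R zero_R add_R zero_D add_D algebra_simps)

lemma uminus_R: "u \<in> D \<Longrightarrow> \<ominus>\<^bsub>R\<^esub> h u = h (- u)"
  by (rule abelian_group.minus_equality[OF abelian_group_R])
    (simp_all add: carrier_R uminus_D add_R zero_R)

lemma minus_R: "u \<in> D \<Longrightarrow> v \<in> D \<Longrightarrow> h u \<ominus>\<^bsub>R\<^esub> h v = h (u - v)"
  by (simp add: a_minus_def uminus_R uminus_D add_R)

end

text \<open>Operations on classes are unions over all representatives. This rule is where their
  independence of representatives is discharged.\<close>

lemma UN_pair_const:
  assumes "X \<noteq> {}" "Y \<noteq> {}"
    and "\<And>a b c d. (a, b) \<in> X \<Longrightarrow> (c, d) \<in> Y \<Longrightarrow> F a b c d = K"
  shows "(\<Union>(a, b)\<in>X. \<Union>(c, d)\<in>Y. F a b c d) = K"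
  using assms by fastforce

subsection \<open>Integers\<close>

definition Z_val :: "'a rel \<Rightarrow> 'a ord2 \<times> 'a ord2 \<Rightarrow> 'a ord_ring" where
  "Z_val r = (\<lambda>(a, b). cnf_embed r a - cnf_embed r b)"

definition Z_class :: "'a rel \<Rightarrow> 'a ord_ring \<Rightarrow> 'a oint" where
  "Z_class r u = {p \<in> N_set r \<times> N_set r. Z_val r p = u}"

definition Z_dom :: "'a rel \<Rightarrow> 'a ord_ring set" where
  "Z_dom r = Z_val r ` (N_set r \<times> N_set r)"

text \<open>Injectivity of \<open>cnf_embed\<close> carries a + d = b + c into the ring, where it
  can be rearranged to a - b = c - d.\<close>

lemma Z_rel_image:
  assumes r: "Well_order r" and p: "p \<in> N_set r \<times> N_set r"
  shows "Z_rel r `` {p} = Z_class r (Z_val r p)"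
proof -
  have "nat_sum a d = nat_sum b c \<longleftrightarrow> Z_val r (c, d) = Z_val r (a, b)"
    if "a \<in> N_set r" "b \<in> N_set r" "c \<in> N_set r" "d \<in> N_set r" for a b c d
  proof -
    have "nat_sum a d = nat_sum b c \<longleftrightarrow>
        cnf_embed r (nat_sum a d) = cnf_embed r (nat_sum b c)"
      using that inj_onD[OF inj_on_cnf_embed[OF r]] by (auto simp: nat_sum_N_set)
    then show ?thesis using that by (auto simp: cnf_embed_nat_sum Z_val_def algebra_simps)
  qed
  then show ?thesis using p by (auto simp: Z_rel_def Z_class_def)
qed

lemma Z_class_nonempty: "u \<in> Z_dom r \<Longrightarrow> Z_class r u \<noteq> {}"
  by (auto simp: Z_dom_def Z_class_def)

lemma Z_valI:
  assumes "a \<in> N_set r" "b \<in> N_set r" "cnf_embed r a - cnf_embed r b = u"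
  shows "u \<in> Z_dom r"
  using assms by (force simp: Z_dom_def Z_val_def)

lemma Z_rel_class:
  assumes "Well_order r" "a \<in> N_set r" "b \<in> N_set r" "cnf_embed r a - cnf_embed r b = u"
  shows "Z_rel r `` {(a, b)} = Z_class r u"
  using Z_rel_image[of r "(a, b)"] assms by (simp add: Z_val_def)

lemma subring_iso_Z:
  assumes r: "Well_order r"
  shows "subring_iso (Z_dom r) (Z_class r) (Z_ring r)"
proof
  note N = nat_sum_N_set nat_prod_N_set zero_N_set one_N_set
  note emb = cnf_embed_nat_sum cnf_embed_nat_prod cnf_embed_zero cnf_embed_one
  have classD: "a \<in> N_set r" "b \<in> N_set r" "u = cnf_embed r a - cnf_embed r b"
    if "(a, b) \<in> Z_class r u" for a b u
    using that by (auto simp: Z_class_def Z_val_def)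
  have domE: thesis
    if "u \<in> Z_dom r"
      "\<And>a b. a \<in> N_set r \<Longrightarrow> b \<in> N_set r \<Longrightarrow> u = cnf_embed r a - cnf_embed r b \<Longrightarrow> thesis"
    for u thesis
    using that by (auto simp: Z_dom_def Z_val_def)
  show "inj_on (Z_class r) (Z_dom r)"
  proof (rule inj_onI)
    fix u v assume "u \<in> Z_dom r" "Z_class r u = Z_class r v"
    then obtain p where "p \<in> Z_class r u" "p \<in> Z_class r v" using Z_class_nonempty by blast
    then show "u = v" by (simp add: Z_class_def)
  qed
  have "carrier (Z_ring r) = (\<lambda>p. Z_rel r `` {p}) ` (N_set r \<times> N_set r)"
    by (auto simp: Z_ring_def quotient_def)
  also have "\<dots> = Z_class r ` Z_dom r"
    unfolding Z_dom_def image_image using Z_rel_image[OF r] by (rule image_cong[OF refl])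
  finally show "carrier (Z_ring r) = Z_class r ` Z_dom r" .
  show "0 \<in> Z_dom r" "1 \<in> Z_dom r"
    using Z_valI[of ord_zero r ord_zero] Z_valI[of ord_one r ord_zero] by (simp_all add: N emb)
  show "\<zero>\<^bsub>Z_ring r\<^esub> = Z_class r 0" "\<one>\<^bsub>Z_ring r\<^esub> = Z_class r 1"
    using r by (simp_all add: Z_ring_def Z_rel_class N emb)
  fix u assume u: "u \<in> Z_dom r"
  then obtain a b where ab: "a \<in> N_set r" "b \<in> N_set r" "u = cnf_embed r a - cnf_embed r b"
    by (rule domE)
  show "- u \<in> Z_dom r" by (rule Z_valI[of b r a]) (simp_all add: ab)
  fix v assume v: "v \<in> Z_dom r"
  then obtain c d where cd: "c \<in> N_set r" "d \<in> N_set r" "v = cnf_embed r c - cnf_embed r d"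
    by (rule domE)
  show "u + v \<in> Z_dom r"
    by (rule Z_valI[of "nat_sum a c" r "nat_sum b d"]) (simp_all add: N emb ab cd)
  show "u * v \<in> Z_dom r"
    by (rule Z_valI[of "nat_sum (nat_prod a c) (nat_prod b d)" r
          "nat_sum (nat_prod a d) (nat_prod b c)"])
      (simp_all add: N emb ab cd algebra_simps)
  show "Z_class r u \<oplus>\<^bsub>Z_ring r\<^esub> Z_class r v = Z_class r (u + v)"
    unfolding Z_ring_def ring_record_simps
  proof (rule UN_pair_const)
    fix a b c d assume ab: "(a, b) \<in> Z_class r u" and cd: "(c, d) \<in> Z_class r v"
    show "Z_rel r `` {(nat_sum a c, nat_sum b d)} = Z_class r (u + v)"
      using classD[OF ab] classD[OF cd] by (intro Z_rel_class[OF r]) (simp_all add: N emb algebra_simps)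
  qed (simp_all add: Z_class_nonempty u v)
  show "Z_class r u \<otimes>\<^bsub>Z_ring r\<^esub> Z_class r v = Z_class r (u * v)"
    unfolding Z_ring_def monoid.simps
  proof (rule UN_pair_const)
    fix a b c d assume ab: "(a, b) \<in> Z_class r u" and cd: "(c, d) \<in> Z_class r v"
    show "Z_rel r `` {(nat_sum (nat_prod a c) (nat_prod b d), nat_sum (nat_prod a d) (nat_prod b c))} =
        Z_class r (u * v)"
      using classD[OF ab] classD[OF cd] by (intro Z_rel_class[OF r]) (simp_all add: N emb, simp add: algebra_simps)
  qed (simp_all add: Z_class_nonempty u v)
  \<comment> \<open>The order on classes asks for one pair of representatives. Since the criterion
    is the same for all of them and classes are nonempty, it decides the order.\<close>
  have "(nat_sum a2 b1, nat_sum a1 b2) \<in> N_le r \<longleftrightarrow> u \<le> v"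
    if "(a1, a2) \<in> Z_class r v" "(b1, b2) \<in> Z_class r u" for a1 a2 b1 b2
  proof -
    have "(nat_sum a2 b1, nat_sum a1 b2) \<in> N_le r \<longleftrightarrow>
        cnf_embed r (nat_sum a2 b1) \<le> cnf_embed r (nat_sum a1 b2)"
      using classD[OF that(1)] classD[OF that(2)] by (simp add: cnf_embed_le_iff[OF r] N)
    then show ?thesis
      using classD[OF that(1)] classD[OF that(2)] by (simp add: emb) (intro iffI; linarith)
  qed
  then show "Z_class r u \<preceq>\<^bsub>Z_ring r\<^esub> Z_class r v \<longleftrightarrow> u \<le> v"
    using Z_class_nonempty[OF u] Z_class_nonempty[OF v] by (fastforce simp: Z_ring_def)
qed

subsection \<open>Fractions\<close>

context subring_iso
begin

definition frac_class :: "'u fract \<Rightarrow> ('r \<times> 'r) set" where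
  "frac_class q = {(h u, h v) | u v. u \<in> D \<and> v \<in> D \<and> v \<noteq> 0 \<and> Fract u v = q}"

definition fracs :: "'u fract set" where
  "fracs = {Fract u v | u v. u \<in> D \<and> v \<in> D \<and> v \<noteq> 0}"

lemma frac_dom_R: "frac_dom R = {(h u, h v) | u v. u \<in> D \<and> v \<in> D \<and> v \<noteq> 0}"
  by (auto simp: frac_dom_def carrier_R zero_R eq_iff zero_D)

lemma frac_rel_class:
  assumes u: "u \<in> D" and v: "v \<in> D" "v \<noteq> 0" and q: "Fract u v = q"
  shows "frac_rel R `` {(h u, h v)} = frac_class q"
proof -
  have "h u \<otimes>\<^bsub>R\<^esub> h v' = h v \<otimes>\<^bsub>R\<^esub> h u' \<longleftrightarrow> Fract u' v' = q"
    if "u' \<in> D" "v' \<in> D" "v' \<noteq> 0" for u' v'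
    using that u v unfolding q[symmetric] by (auto simp: mult_R mult_D eq_iff eq_fract mult.commute)
  then show ?thesis
    using u v by (auto simp: frac_rel_def frac_dom_R frac_class_def)
qed

lemma fracsE:
  assumes "q \<in> fracs"
  obtains u v where "u \<in> D" "v \<in> D" "v \<noteq> 0" "q = Fract u v"
  using assms by (auto simp: fracs_def)

lemma fracsI: "u \<in> D \<Longrightarrow> v \<in> D \<Longrightarrow> v \<noteq> 0 \<Longrightarrow> q = Fract u v \<Longrightarrow> q \<in> fracs"
  by (auto simp: fracs_def)

lemma frac_class_nonempty: "q \<in> fracs \<Longrightarrow> frac_class q \<noteq> {}"
  by (auto simp: fracs_def frac_class_def)

lemma frac_classE:
  assumes "(x, y) \<in> frac_class q"
  obtains u v where "u \<in> D" "v \<in> D" "v \<noteq> 0" "q = Fract u v" "x = h u" "y = h v"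
  using assms by (auto simp: frac_class_def)

lemma inverse_fracs: "q \<in> fracs \<Longrightarrow> inverse q \<in> fracs"
proof (erule fracsE)
  fix u v assume uv: "u \<in> D" "v \<in> D" "v \<noteq> 0" "q = Fract u v"
  show "inverse q \<in> fracs"
  \<comment> \<open>In a field type the inverse of 0 is 0, which has to be represented as 0/1
    instead of by exchanging numerator and denominator.\<close>
  proof (cases "u = 0")
    case True
    then show ?thesis
      using uv by (intro fracsI[of 0 1]) (simp_all add: fract_collapse zero_D one_D)
  next
    case False
    then show ?thesis using uv by (intro fracsI[of v u]) simp_all
  qed
qed

lemma subring_iso_frac_field: "subring_iso fracs frac_class (frac_field R)"
proof
  show "inj_on frac_class fracs"
  proof (rule inj_onI)
    fix p q assume "p \<in> fracs" "frac_class p = frac_class q"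
    then obtain x y where "(x, y) \<in> frac_class p" "(x, y) \<in> frac_class q"
      using frac_class_nonempty by fast
    then show "p = q" by (auto simp: eq_iff elim!: frac_classE)
  qed
  have "carrier (frac_field R) = (\<lambda>p. frac_rel R `` {p}) ` frac_dom R"
    by (auto simp: frac_field_def quotient_def)
  also have "\<dots> = frac_class ` fracs"
  proof (intro equalityI subsetI)
    fix X assume "X \<in> (\<lambda>p. frac_rel R `` {p}) ` frac_dom R"
    then obtain u v where "u \<in> D" "v \<in> D" "v \<noteq> 0" "X = frac_rel R `` {(h u, h v)}"
      by (auto simp: frac_dom_R)
    then show "X \<in> frac_class ` fracs" using frac_rel_class fracsI by auto
  next
    fix X assume "X \<in> frac_class ` fracs"
    then obtain u v where "u \<in> D" "v \<in> D" "v \<noteq> 0" "X = frac_class (Fract u v)"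
      by (auto elim: fracsE)
    then have "X = frac_rel R `` {(h u, h v)}" "(h u, h v) \<in> frac_dom R"
      by (auto simp: frac_rel_class frac_dom_R)
    then show "X \<in> (\<lambda>p. frac_rel R `` {p}) ` frac_dom R" by blast
  qed
  finally show "carrier (frac_field R) = frac_class ` fracs" .
  show "0 \<in> fracs" "1 \<in> fracs"
    using fracsI[OF zero_D one_D] fracsI[OF one_D one_D] by (simp_all add: fract_collapse)
  show "\<zero>\<^bsub>frac_field R\<^esub> = frac_class 0" "\<one>\<^bsub>frac_field R\<^esub> = frac_class 1"
    by (simp_all add: frac_field_def zero_R one_R frac_rel_class zero_D one_D fract_collapse)
  fix p q assume p: "p \<in> fracs"
  then obtain u v where uv: "u \<in> D" "v \<in> D" "v \<noteq> 0" "p = Fract u v" by (rule fracsE)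
  show "- p \<in> fracs" by (rule fracsI[of "- u" v]) (simp_all add: uv uminus_D)
  assume q: "q \<in> fracs"
  then obtain s t where st: "s \<in> D" "t \<in> D" "t \<noteq> 0" "q = Fract s t" by (rule fracsE)
  note ops = add_D mult_D diff_D add_R mult_R minus_R
  show "p + q \<in> fracs"
    by (rule fracsI[of "u * t + s * v" "v * t"]) (simp_all add: uv st ops)
  show "p * q \<in> fracs" by (rule fracsI[of "u * s" "v * t"]) (simp_all add: uv st ops)
  show "frac_class p \<oplus>\<^bsub>frac_field R\<^esub> frac_class q = frac_class (p + q)"
    unfolding frac_field_def ring_record_simps
  proof (rule UN_pair_const)
    fix a b c d assume "(a, b) \<in> frac_class p" "(c, d) \<in> frac_class q"
    then show "frac_rel R `` {(a \<otimes>\<^bsub>R\<^esub> d \<oplus>\<^bsub>R\<^esub> b \<otimes>\<^bsub>R\<^esub> c, b \<otimes>\<^bsub>R\<^esub> d)} = frac_class (p + q)"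
      by (elim frac_classE) (simp add: ops frac_rel_class mult.commute)
  qed (simp_all add: frac_class_nonempty p q)
  show "frac_class p \<otimes>\<^bsub>frac_field R\<^esub> frac_class q = frac_class (p * q)"
    unfolding frac_field_def monoid.simps
  proof (rule UN_pair_const)
    fix a b c d assume "(a, b) \<in> frac_class p" "(c, d) \<in> frac_class q"
    then show "frac_rel R `` {(a \<otimes>\<^bsub>R\<^esub> c, b \<otimes>\<^bsub>R\<^esub> d)} = frac_class (p * q)"
      by (elim frac_classE) (simp add: ops frac_rel_class mult.commute)
  qed (simp_all add: frac_class_nonempty p q)
  \<comment> \<open>The order of the fraction field is the sign of a difference formed by
    \<open>frac_minus\<close> directly on classes, so this operation is computed separately.\<close>
  have minus: "frac_minus R (frac_class q) (frac_class p) = frac_class (q - p)"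
    unfolding frac_minus_def
  proof (rule UN_pair_const)
    fix a b c d assume "(a, b) \<in> frac_class q" "(c, d) \<in> frac_class p"
    then show "frac_rel R `` {(a \<otimes>\<^bsub>R\<^esub> d \<ominus>\<^bsub>R\<^esub> b \<otimes>\<^bsub>R\<^esub> c, b \<otimes>\<^bsub>R\<^esub> d)} = frac_class (q - p)"
      by (elim frac_classE) (simp add: ops frac_rel_class mult.commute)
  qed (simp_all add: frac_class_nonempty p q)
  \<comment> \<open>With 0 written as 0/1, the order of \<open>fract\<close> compares 0 with
    numerator times denominator; the denominator may have either sign.\<close>
  have "\<zero>\<^bsub>R\<^esub> \<preceq>\<^bsub>R\<^esub> x \<otimes>\<^bsub>R\<^esub> y \<longleftrightarrow> 0 \<le> d" if "(x, y) \<in> frac_class d" for x y d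
    using that by (auto simp: zero_R ops le_R zero_D fract_expand(1) elim!: frac_classE)
  moreover have "q - p \<in> fracs"
    by (rule fracsI[of "s * v - u * t" "t * v"]) (simp_all add: uv st ops)
  ultimately have "frac_nonneg R (frac_class (q - p)) \<longleftrightarrow> 0 \<le> q - p"
    using frac_class_nonempty unfolding frac_nonneg_def by fast
  then show "frac_class p \<preceq>\<^bsub>frac_field R\<^esub> frac_class q \<longleftrightarrow> p \<le> q"
    by (simp add: frac_field_def minus)
qed

end

section \<open>Proper cuts of a subfield\<close>

locale ordered_subfield =
  fixes S :: "'u::linordered_field set"
  assumes zero_S: "0 \<in> S" and one_S: "1 \<in> S"
    and add_S: "x \<in> S \<Longrightarrow> y \<in> S \<Longrightarrow> x + y \<in> S"
    and uminus_S: "x \<in> S \<Longrightarrow> - x \<in> S"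
    and mult_S: "x \<in> S \<Longrightarrow> y \<in> S \<Longrightarrow> x * y \<in> S"
    and inverse_S: "x \<in> S \<Longrightarrow> inverse x \<in> S"
begin

lemma diff_S: "x \<in> S \<Longrightarrow> y \<in> S \<Longrightarrow> x - y \<in> S"
  using add_S[of x "- y"] uminus_S by simp

lemma divide_S: "x \<in> S \<Longrightarrow> y \<in> S \<Longrightarrow> x / y \<in> S"
  using mult_S[of x "inverse y"] inverse_S by (simp add: field_simps)

lemma two_S: "2 \<in> S"
  using add_S[OF one_S one_S] by simp

lemmas closed_S [simp] = zero_S one_S two_S add_S uminus_S mult_S inverse_S diff_S divide_S

text \<open>
  The last clause expresses properness; it implies that at most one point of \<open>S\<close> is omitted.
\<close>

definition pcut :: "'u cut \<Rightarrow> bool" where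
  "pcut X \<longleftrightarrow> fst X \<subseteq> S \<and> snd X \<subseteq> S \<and>
     (\<forall>a\<in>fst X. \<forall>x\<in>S. x \<le> a \<longrightarrow> x \<in> fst X) \<and>
     (\<forall>b\<in>snd X. \<forall>x\<in>S. b \<le> x \<longrightarrow> x \<in> snd X) \<and>
     (\<forall>a\<in>fst X. \<exists>a'\<in>fst X. a < a') \<and>
     (\<forall>b\<in>snd X. \<exists>b'\<in>snd X. b' < b) \<and>
     (\<forall>a\<in>fst X. \<forall>b\<in>snd X. a < b) \<and>
     (\<forall>d\<in>S. 0 < d \<longrightarrow> (\<exists>a\<in>fst X. \<exists>b\<in>snd X. b - a < d))"

lemma pcutI:
  assumes "\<And>a. a \<in> A \<Longrightarrow> a \<in> S" "\<And>b. b \<in> B \<Longrightarrow> b \<in> S"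
    and "\<And>a x. a \<in> A \<Longrightarrow> x \<in> S \<Longrightarrow> x \<le> a \<Longrightarrow> x \<in> A"
    and "\<And>b x. b \<in> B \<Longrightarrow> x \<in> S \<Longrightarrow> b \<le> x \<Longrightarrow> x \<in> B"
    and "\<And>a. a \<in> A \<Longrightarrow> \<exists>a'\<in>A. a < a'"
    and "\<And>b. b \<in> B \<Longrightarrow> \<exists>b'\<in>B. b' < b"
    and "\<And>a b. a \<in> A \<Longrightarrow> b \<in> B \<Longrightarrow> a < b"
    and "\<And>d. d \<in> S \<Longrightarrow> 0 < d \<Longrightarrow> \<exists>a\<in>A. \<exists>b\<in>B. b - a < d"
  shows "pcut (A, B)"
  unfolding pcut_def fst_conv snd_conv
  by (intro conjI ballI impI subsetI) (fact assms)+

lemma pcutD: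
  assumes "pcut X"
  shows "a \<in> fst X \<Longrightarrow> a \<in> S" "b \<in> snd X \<Longrightarrow> b \<in> S"
    and "a \<in> fst X \<Longrightarrow> x \<in> S \<Longrightarrow> x \<le> a \<Longrightarrow> x \<in> fst X"
    and "b \<in> snd X \<Longrightarrow> x \<in> S \<Longrightarrow> b \<le> x \<Longrightarrow> x \<in> snd X"
    and "a \<in> fst X \<Longrightarrow> b \<in> snd X \<Longrightarrow> a < b"
proof -
  have *: "fst X \<subseteq> S" "snd X \<subseteq> S" "\<forall>a\<in>fst X. \<forall>b\<in>snd X. a < b"
    "\<forall>a\<in>fst X. \<forall>x\<in>S. x \<le> a \<longrightarrow> x \<in> fst X" "\<forall>b\<in>snd X. \<forall>x\<in>S. b \<le> x \<longrightarrow> x \<in> snd X"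
    using assms unfolding pcut_def by - (elim conjE, assumption)+
  show "a \<in> fst X \<Longrightarrow> a \<in> S" "b \<in> snd X \<Longrightarrow> b \<in> S" "a \<in> fst X \<Longrightarrow> b \<in> snd X \<Longrightarrow> a < b"
    using *(1-3) by blast+
  show "a \<in> fst X \<Longrightarrow> x \<in> S \<Longrightarrow> x \<le> a \<Longrightarrow> x \<in> fst X" using *(4) by blast
  show "b \<in> snd X \<Longrightarrow> x \<in> S \<Longrightarrow> b \<le> x \<Longrightarrow> x \<in> snd X" using *(5) by blast
qed

lemma pcut_above:
  assumes "pcut X" "a \<in> fst X"
  obtains a' where "a' \<in> fst X" "a < a'"
proof -
  have "\<forall>a\<in>fst X. \<exists>a'\<in>fst X. a < a'" using assms(1) unfolding pcut_def by (elim conjE)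
  then show ?thesis using assms(2) that by (meson bspec bexE)
qed

lemma pcut_below:
  assumes "pcut X" "b \<in> snd X"
  obtains b' where "b' \<in> snd X" "b' < b"
proof -
  have "\<forall>b\<in>snd X. \<exists>b'\<in>snd X. b' < b" using assms(1) unfolding pcut_def by (elim conjE)
  then show ?thesis using assms(2) that by (meson bspec bexE)
qed

lemma pcut_tight:
  assumes "pcut X" "d \<in> S" "0 < d"
  obtains a b where "a \<in> fst X" "b \<in> snd X" "b - a < d"
proof -
  have "\<forall>d\<in>S. 0 < d \<longrightarrow> (\<exists>a\<in>fst X. \<exists>b\<in>snd X. b - a < d)"
    using assms(1) unfolding pcut_def by (elim conjE)
  then have "\<exists>a\<in>fst X. \<exists>b\<in>snd X. b - a < d" using assms(2,3) by blast
  then show ?thesis using that by blast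
qed

text \<open>Raising \<open>a\<close> to at least \<open>a0\<close> and lowering \<open>b\<close> to
  at most \<open>b0\<close> only shrinks the difference. The bounds are what the estimates for
  products and inverses need.\<close>

lemma pcut_tight_within:
  assumes X: "pcut X" "d \<in> S" "0 < d" and ab: "a0 \<in> fst X" "b0 \<in> snd X"
  obtains a b where "a \<in> fst X" "b \<in> snd X" "b - a < d" "a0 \<le> a" "b \<le> b0"
proof -
  obtain a b where ab': "a \<in> fst X" "b \<in> snd X" "b - a < d" by (rule pcut_tight[OF X])
  show ?thesis
    by (rule that[of "max a a0" "min b b0"]) (use ab ab' in \<open>auto simp: max_def min_def\<close>)
qed

lemma pcut_nonempty:
  assumes "pcut X"
  obtains a b where "a \<in> fst X" "b \<in> snd X"
  by (rule pcut_tight[OF assms one_S zero_less_one]) (rule that)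

section \<open>The order of proper cuts\<close>

lemma pcut_le_iff:
  assumes X: "pcut X" and Y: "pcut Y"
  shows "cut_le X Y \<longleftrightarrow> (\<forall>a\<in>fst X. \<forall>b\<in>snd Y. a < b)"
proof
  assume "cut_le X Y"
  then show "\<forall>a\<in>fst X. \<forall>b\<in>snd Y. a < b"
    unfolding cut_le_def using pcutD(5)[OF Y] by blast
next
  assume cross: "\<forall>a\<in>fst X. \<forall>b\<in>snd Y. a < b"
  show "cut_le X Y"
    unfolding cut_le_def
  proof (rule subsetI, rule ccontr)
    fix a assume a: "a \<in> fst X" "a \<notin> fst Y"
    \<comment> \<open>As \<open>fst X\<close> has no greatest element, there is a gap of positive
      length a' - a. Every close pair of \<open>Y\<close> would have to straddle it: c < a < a' <
      d.\<close>
    obtain a' where a': "a' \<in> fst X" "a < a'" by (rule pcut_above[OF X a(1)])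
    have "a' - a \<in> S" using a a' pcutD(1)[OF X] by simp
    then obtain c d where cd: "c \<in> fst Y" "d \<in> snd Y" "d - c < a' - a"
      using a'(2) by (elim pcut_tight[OF Y]) auto
    have "c < a" using pcutD(3)[OF Y cd(1), of a] a pcutD(1)[OF X] by force
    moreover have "a' < d" using cross a'(1) cd(2) by blast
    ultimately show False using cd(3) by linarith
  qed
qed

lemma pcut_total: "pcut X \<Longrightarrow> pcut Y \<Longrightarrow> cut_le X Y \<or> cut_le Y X"
  unfolding cut_le_def by (meson linear pcutD(1,3) subsetI)

lemma pcut_antisym:
  assumes X: "pcut X" and Y: "pcut Y" and "cut_le X Y" "cut_le Y X"
  shows "X = Y"
proof -
  have eq: "fst X = fst Y" using assms by (auto simp: cut_le_def)
  \<comment> \<open>\<open>cut_le\<close> sees first components only. Equality of the second ones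
    follows by the same straddling argument, now on the interval from b' to b.\<close>
  have *: "snd X' \<subseteq> snd Y'" if X': "pcut X'" and Y': "pcut Y'" and eq: "fst X' = fst Y'" for X' Y'
  proof (rule subsetI, rule ccontr)
    fix b assume b: "b \<in> snd X'" "b \<notin> snd Y'"
    obtain b' where b': "b' \<in> snd X'" "b' < b" by (rule pcut_below[OF X' b(1)])
    have "b - b' \<in> S" using b b' pcutD(2)[OF X'] by simp
    then obtain c d where cd: "c \<in> fst Y'" "d \<in> snd Y'" "d - c < b - b'"
      using b'(2) by (elim pcut_tight[OF Y']) auto
    have "b < d" using pcutD(4)[OF Y' cd(2), of b] b pcutD(2)[OF X'] by force
    moreover have "c < b'" using pcutD(5)[OF X'] b'(1) cd(1) eq by blast
    ultimately show False using cd(3) by linarith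
  qed
  show ?thesis using eq *[OF X Y eq] *[OF Y X] by (auto intro: prod_eqI)
qed

lemma pcut_eqI:
  assumes "pcut X" "pcut Y"
    and "\<And>a b. a \<in> fst X \<Longrightarrow> b \<in> snd Y \<Longrightarrow> a < b" "\<And>a b. a \<in> fst Y \<Longrightarrow> b \<in> snd X \<Longrightarrow> a < b"
  shows "X = Y"
  using assms pcut_antisym pcut_le_iff by blast

definition rat_cut :: "'u \<Rightarrow> 'u cut" where
  "rat_cut s = ({q \<in> S. q < s}, {q \<in> S. s < q})"

lemma pcut_rat_cut:
  assumes "s \<in> S"
  shows "pcut (rat_cut s)"
  unfolding rat_cut_def
proof (rule pcutI)
  fix a assume "a \<in> {q \<in> S. q < s}"
  then have "(a + s) / 2 \<in> {q \<in> S. q < s}" "a < (a + s) / 2"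
    using assms by (auto simp: field_simps)
  then show "\<exists>a'\<in>{q \<in> S. q < s}. a < a'" by blast
next
  fix b assume "b \<in> {q \<in> S. s < q}"
  then have "(b + s) / 2 \<in> {q \<in> S. s < q}" "(b + s) / 2 < b"
    using assms by (auto simp: field_simps)
  then show "\<exists>b'\<in>{q \<in> S. s < q}. b' < b" by blast
next
  fix d :: 'u assume d: "d \<in> S" "0 < d"
  \<comment> \<open>The elements s - h and s + h must be strictly less than d apart, so half of d
    would not do. Halving twice keeps membership in \<open>S\<close> a matter of
    \<open>two_S\<close>.\<close>
  define h where "h = d / 2 / 2"
  have "h \<in> S" unfolding h_def by (intro divide_S two_S d)
  moreover have "0 < h" "h + h < d" using d(2) by (simp_all add: h_def)
  ultimately show "\<exists>a\<in>{q \<in> S. q < s}. \<exists>b\<in>{q \<in> S. s < q}. b - a < d"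
    using assms by (intro bexI[of _ "s - h"] bexI[of _ "s + h"]) auto
qed auto

section \<open>Sums and opposites of proper cuts\<close>

definition psum :: "'u cut \<Rightarrow> 'u cut \<Rightarrow> 'u cut" where
  "psum X Y = (fst X + fst Y, snd X + snd Y)"

definition pneg :: "'u cut \<Rightarrow> 'u cut" where
  "pneg X = (uminus ` snd X, uminus ` fst X)"

lemma psum_commute: "psum X Y = psum Y X"
  unfolding psum_def by (simp add: add.commute)

lemma psum_assoc: "psum (psum X Y) Z = psum X (psum Y Z)"
  unfolding psum_def by (simp add: add.assoc)

lemma pneg_pneg [simp]: "pneg (pneg X) = X"
  unfolding pneg_def by (simp add: image_image)

lemma pneg_psum: "pneg (psum X Y) = psum (pneg X) (pneg Y)"
proof -
  have "uminus ` (A + C) = uminus ` A + uminus ` C" for A C :: "'u set"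
    by (auto simp: image_iff elim!: set_plus_elim)
      (metis set_plus_intro imageI uminus_add_conv_diff add.commute minus_add_distrib)+
  then show ?thesis by (simp add: pneg_def psum_def)
qed

lemma pcut_pneg:
  assumes X: "pcut X"
  shows "pcut (pneg X)"
  unfolding pneg_def
proof (rule pcutI)
  fix a x assume "a \<in> uminus ` snd X" "x \<in> S" "x \<le> a"
  then have "- x \<in> snd X" using pcutD(4)[OF X, of "- a" "- x"] by auto
  then show "x \<in> uminus ` snd X" by force
next
  fix a x assume "a \<in> uminus ` fst X" "x \<in> S" "a \<le> x"
  then have "- x \<in> fst X" using pcutD(3)[OF X, of "- a" "- x"] by auto
  then show "x \<in> uminus ` fst X" by force
next
  fix d assume "d \<in> S" "0 < d"
  then obtain a b where "a \<in> fst X" "b \<in> snd X" "b - a < d" by (rule pcut_tight[OF X])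
  then show "\<exists>a\<in>uminus ` snd X. \<exists>b\<in>uminus ` fst X. b - a < d"
    by (intro bexI[of _ "- b"] bexI[of _ "- a"]) auto
next
  fix a assume "a \<in> uminus ` snd X"
  then obtain b where b: "b \<in> snd X" "a = - b" by blast
  obtain b' where "b' \<in> snd X" "b' < b" by (rule pcut_below[OF X b(1)])
  then show "\<exists>a'\<in>uminus ` snd X. a < a'" using b by auto
next
  fix b assume "b \<in> uminus ` fst X"
  then obtain a where a: "a \<in> fst X" "b = - a" by blast
  obtain a' where "a' \<in> fst X" "a < a'" by (rule pcut_above[OF X a(1)])
  then show "\<exists>b'\<in>uminus ` fst X. b' < b" using a by auto
qed (use pcutD(1,2,5)[OF X] in auto)

lemma pcut_psum:
  assumes X: "pcut X" and Y: "pcut Y"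
  shows "pcut (psum X Y)"
  unfolding psum_def
proof (rule pcutI)
  fix s x assume "s \<in> fst X + fst Y" and x: "x \<in> S" "x \<le> s"
  then obtain a c where s: "s = a + c" "a \<in> fst X" "c \<in> fst Y" by (elim set_plus_elim)
  have "x - a \<in> fst Y"
    using pcutD(3)[OF Y s(3), of "x - a"] s x pcutD(1)[OF X] by (simp add: algebra_simps)
  then show "x \<in> fst X + fst Y" using set_plus_intro[OF s(2)] by force
next
  fix s x assume "s \<in> snd X + snd Y" and x: "x \<in> S" "s \<le> x"
  then obtain b d where s: "s = b + d" "b \<in> snd X" "d \<in> snd Y" by (elim set_plus_elim)
  have "x - b \<in> snd Y"
    using pcutD(4)[OF Y s(3), of "x - b"] s x pcutD(2)[OF X] by (simp add: algebra_simps)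
  then show "x \<in> snd X + snd Y" using set_plus_intro[OF s(2)] by force
next
  fix s assume "s \<in> fst X + fst Y"
  then obtain a c where s: "s = a + c" "a \<in> fst X" "c \<in> fst Y" by (elim set_plus_elim)
  obtain a' where "a' \<in> fst X" "a < a'" by (rule pcut_above[OF X s(2)])
  then show "\<exists>s'\<in>fst X + fst Y. s < s'"
    using s by (intro bexI[of _ "a' + c"]) (auto intro: set_plus_intro)
next
  fix s assume "s \<in> snd X + snd Y"
  then obtain b d where s: "s = b + d" "b \<in> snd X" "d \<in> snd Y" by (elim set_plus_elim)
  obtain b' where "b' \<in> snd X" "b' < b" by (rule pcut_below[OF X s(2)])
  then show "\<exists>s'\<in>snd X + snd Y. s' < s"
    using s by (intro bexI[of _ "b' + d"]) (auto intro: set_plus_intro)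
next
  fix e :: 'u assume e: "e \<in> S" "0 < e"
  then have h: "e / 2 \<in> S" "0 < e / 2" by simp_all
  obtain a b where ab: "a \<in> fst X" "b \<in> snd X" "b - a < e / 2" by (rule pcut_tight[OF X h])
  obtain c d where cd: "c \<in> fst Y" "d \<in> snd Y" "d - c < e / 2" by (rule pcut_tight[OF Y h])
  have "(b + d) - (a + c) < e" using ab(3) cd(3) by (simp add: field_simps)
  then show "\<exists>s\<in>fst X + fst Y.
      \<exists>t\<in>snd X + snd Y. t - s < e"
    using ab cd by (intro bexI[of _ "a + c"] bexI[of _ "b + d"]) (auto intro: set_plus_intro)
qed (use pcutD(1,2,5)[OF X] pcutD(1,2,5)[OF Y] in \<open>auto intro: add_strict_mono elim!: set_plus_elim\<close>)

lemma psum_zero: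
  assumes X: "pcut X"
  shows "psum (rat_cut 0) X = X"
proof (rule pcut_eqI[OF pcut_psum[OF pcut_rat_cut[OF zero_S] X] X])
  fix a b assume "a \<in> fst (psum (rat_cut 0) X)" and b: "b \<in> snd X"
  then obtain q c where "a = q + c" "q < 0" "c \<in> fst X" by (auto simp: psum_def rat_cut_def elim!: set_plus_elim)
  then show "a < b" using pcutD(5)[OF X _ b, of c] by linarith
next
  fix a b assume a: "a \<in> fst X" and "b \<in> snd (psum (rat_cut 0) X)"
  then obtain q c where "b = q + c" "0 < q" "c \<in> snd X" by (auto simp: psum_def rat_cut_def elim!: set_plus_elim)
  then show "a < b" using pcutD(5)[OF X a, of c] by linarith
qed

lemma psum_pneg:
  assumes X: "pcut X"
  shows "psum (pneg X) X = rat_cut 0"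
proof (rule pcut_eqI[OF pcut_psum[OF pcut_pneg[OF X] X] pcut_rat_cut[OF zero_S]])
  fix a b assume "a \<in> fst (psum (pneg X) X)" and b: "b \<in> snd (rat_cut 0)"
  then obtain q c where "a = - q + c" "q \<in> snd X" "c \<in> fst X" by (auto simp: psum_def pneg_def elim!: set_plus_elim)
  then show "a < b" using b pcutD(5)[OF X, of c q] by (simp add: rat_cut_def)
next
  fix a b assume a: "a \<in> fst (rat_cut 0)" and "b \<in> snd (psum (pneg X) X)"
  then obtain q c where "b = - q + c" "q \<in> fst X" "c \<in> snd X" by (auto simp: psum_def pneg_def elim!: set_plus_elim)
  then show "a < b" using a pcutD(5)[OF X, of q c] by (simp add: rat_cut_def)
qed

lemma psum_mono: "cut_le X Y \<Longrightarrow> cut_le (psum X Z) (psum Y Z)"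
  unfolding cut_le_def psum_def by (simp add: set_plus_mono2)

subsection \<open>Products of nonnegative cuts\<close>

definition pnonneg :: "'u cut \<Rightarrow> bool" where
  "pnonneg X \<longleftrightarrow> cut_le (rat_cut 0) X"

definition pprod :: "'u cut \<Rightarrow> 'u cut \<Rightarrow> 'u cut" where
  "pprod X Y =
    ({q \<in> S. q < 0} \<union> {a \<in> fst X. 0 \<le> a} * {c \<in> fst Y. 0 \<le> c},
     snd X * snd Y)"

text \<open>The bound is strict because the upper component has no least element: below any
  \<open>b\<close> there is an upper \<open>b'\<close>, which is itself not negative.\<close>

lemma pnonneg_iff: "pcut X \<Longrightarrow> pnonneg X \<longleftrightarrow> (\<forall>b\<in>snd X. 0 < b)"
proof
  assume X: "pcut X" and nn: "pnonneg X"
  show "\<forall>b\<in>snd X. 0 < b"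
  proof
    fix b assume b: "b \<in> snd X"
    obtain b' where b': "b' \<in> snd X" "b' < b" by (rule pcut_below[OF X b])
    have "\<not> b' < 0"
    proof
      assume "b' < 0"
      then have "b' \<in> fst X" using nn b' pcutD(2)[OF X]
        by (auto simp: pnonneg_def cut_le_def rat_cut_def)
      then show False using pcutD(5)[OF X _ b'(1)] by blast
    qed
    then show "0 < b" using b' by linarith
  qed
next
  assume X: "pcut X" and pos: "\<forall>b\<in>snd X. 0 < b"
  then show "pnonneg X"
    unfolding pnonneg_def pcut_le_iff[OF pcut_rat_cut[OF zero_S] X] by (force simp: rat_cut_def)
qed

lemma pprod_commute: "pprod X Y = pprod Y X"
  unfolding pprod_def by (simp add: mult.commute)

text \<open>Only \<open>a\<close> has to be nonnegative. In the proof of distributivity the second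
  factor is a sum that is nonnegative although one of its terms may be negative.\<close>

lemma mult_less_of_pcut:
  assumes X: "pcut X" "pnonneg X" and Y: "pcut Y" "pnonneg Y"
    and "a \<in> fst X" "b \<in> snd X" "c \<in> fst Y" "d \<in> snd Y" "0 \<le> a"
  shows "a * c < b * d"
proof -
  have "a < b" "c < d" "0 < b" "0 < d"
    using assms pcutD(5)[OF X(1)] pcutD(5)[OF Y(1)] pnonneg_iff by blast+
  show ?thesis
  proof (cases "0 \<le> c")
    case True
    then show ?thesis using \<open>a < b\<close> \<open>c < d\<close> \<open>0 \<le> a\<close> by (simp add: mult_strict_mono')
  next
    case False
    then have "a * c \<le> 0" using \<open>0 \<le> a\<close> by (simp add: mult_nonneg_nonpos)
    also have "0 < b * d" using \<open>0 < b\<close> \<open>0 < d\<close> by simp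
    finally show ?thesis .
  qed
qed

lemma pcut_pprod:
  assumes X: "pcut X" "pnonneg X" and Y: "pcut Y" "pnonneg Y"
  shows "pcut (pprod X Y)"
proof -
  have posX: "0 < b" if "b \<in> snd X" for b using that X pnonneg_iff by blast
  have posY: "0 < b" if "b \<in> snd Y" for b using that Y pnonneg_iff by blast
  let ?A = "{q \<in> S. q < 0} \<union> {a \<in> fst X. 0 \<le> a} * {c \<in> fst Y. 0 \<le> c}"
  let ?B = "snd X * snd Y"
  show ?thesis
    unfolding pprod_def
  proof (rule pcutI)
    fix s x assume s: "s \<in> ?A" and x: "x \<in> S" "x \<le> s"
    show "x \<in> ?A"
    proof (cases "x < 0")
      case False
      then obtain a c where ac: "s = a * c" "a \<in> fst X" "c \<in> fst Y" "0 \<le> a" "0 \<le> c"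
        using s x by (auto elim!: set_times_elim)
      show ?thesis
      \<comment> \<open>The factorisation x = a * (x / a) needs a nonzero \<open>a\<close>;
        otherwise 0 \<le> x \<le> 0 makes \<open>x\<close> equal to the product already
        given.\<close>
      proof (cases "a = 0")
        case True
        then have "x = a * c" using ac x False by simp
        then show ?thesis using ac by (auto intro!: set_times_intro)
      next
        case a: False
        have "x / a \<in> S" using x ac pcutD(1)[OF X(1)] by simp
        moreover have "x / a \<le> c" "0 \<le> x / a" "x = a * (x / a)"
          using a ac x False by (auto simp: field_simps)
        ultimately have "x / a \<in> {c \<in> fst Y. 0 \<le> c}" using pcutD(3)[OF Y(1) ac(3)] by blast
        then have "a * (x / a) \<in> {a \<in> fst X. 0 \<le> a} * {c \<in> fst Y. 0 \<le> c}"
          using ac by (intro set_times_intro) auto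
        then show ?thesis using \<open>x = a * (x / a)\<close> by simp
      qed
    qed (use x in auto)
  next
    fix s x assume "s \<in> ?B" and x: "x \<in> S" "s \<le> x"
    then obtain b d where bd: "s = b * d" "b \<in> snd X" "d \<in> snd Y" by (elim set_times_elim)
    have "x / b \<in> S" using x bd pcutD(2)[OF X(1)] by simp
    moreover have "d \<le> x / b" "x = b * (x / b)"
      using bd x posX[OF bd(2)] by (auto simp: field_simps)
    ultimately show "x \<in> ?B" using set_times_intro[OF bd(2), of "x / b"] pcutD(4)[OF Y(1) bd(3)] by simp
  next
    fix s assume "s \<in> ?A"
    then consider "s \<in> S" "s < 0"
      | a c where "s = a * c" "a \<in> fst X" "c \<in> fst Y" "0 \<le> a" "0 \<le> c"
      by (auto elim!: set_times_elim)
    then show "\<exists>s'\<in>?A. s < s'"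
    proof cases
      case 1
      then show ?thesis by (intro bexI[of _ "s / 2"]) auto
    next
      case 2
      obtain a' where "a' \<in> fst X" "a < a'" by (rule pcut_above[OF X(1) 2(2)])
      moreover obtain c' where "c' \<in> fst Y" "c < c'" by (rule pcut_above[OF Y(1) 2(3)])
      ultimately show ?thesis using 2
        by (intro bexI[of _ "a' * c'"] UnI2 set_times_intro) (auto simp: mult_strict_mono')
    qed
  next
    fix s assume "s \<in> ?B"
    then obtain b d where bd: "s = b * d" "b \<in> snd X" "d \<in> snd Y" by (elim set_times_elim)
    obtain b' where "b' \<in> snd X" "b' < b" by (rule pcut_below[OF X(1) bd(2)])
    then show "\<exists>s'\<in>?B. s' < s"
      using bd posY[OF bd(3)] by (intro bexI[of _ "b' * d"]) (auto intro: set_times_intro)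
  next
    fix s t assume "s \<in> ?A" "t \<in> ?B"
    then show "s < t"
      using mult_less_of_pcut[OF X Y] posX posY
      by (auto elim!: set_times_elim intro: less_trans[OF _ mult_pos_pos])
  next
    fix e :: 'u assume e: "e \<in> S" "0 < e"
    obtain a0 b0 where b0: "a0 \<in> fst X" "b0 \<in> snd X" by (rule pcut_nonempty[OF X(1)])
    obtain c0 d0 where d0: "c0 \<in> fst Y" "d0 \<in> snd Y" by (rule pcut_nonempty[OF Y(1)])
    \<comment> \<open>From b * d - a * c = b * (d - c) + c * (b - a), pairs of width below h with b
      \<le> b0 and d \<le> d0 leave an error of at most h * b0 + h * d0. The summand 1 leaves a
      further h, which makes the bound strict.\<close>
    define h where "h = e / (b0 + d0 + 1)"
    have M: "0 < b0 + d0 + 1" using posX[OF b0(2)] posY[OF d0(2)] by linarith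
    then have h: "h \<in> S" "0 < h" "h * (b0 + d0 + 1) = e"
      unfolding h_def using e b0 d0 pcutD(2)[OF X(1)] pcutD(2)[OF Y(1)]
      by (auto)
    obtain a b where ab: "a \<in> fst X" "b \<in> snd X" "b - a < h" "b \<le> b0"      by (rule pcut_tight_within[OF X(1) h(1,2) b0])
    obtain c d where cd: "c \<in> fst Y" "d \<in> snd Y" "d - c < h" "d \<le> d0"      by (rule pcut_tight_within[OF Y(1) h(1,2) d0])
    have bd: "b * d \<in> ?B" "0 < b" "0 < d" using ab cd posX posY by (auto intro: set_times_intro)
    have he: "h * b0 + h * d0 + h = e" using h(3) by (simp add: algebra_simps)
    show "\<exists>s\<in>?A. \<exists>t\<in>?B. t - s < e"
    proof (cases "0 \<le> a \<and> 0 \<le> c")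
      case True
      have "c < d" using pcutD(5)[OF Y(1)] cd by blast
      have "b * (d - c) \<le> b0 * h" using True ab cd bd \<open>c < d\<close> by (intro mult_mono) auto
      moreover have "c * (b - a) \<le> d0 * h"
        using True ab cd bd \<open>c < d\<close> pcutD(5)[OF X(1) ab(1,2)] by (intro mult_mono) auto
      moreover have "b * d - a * c = b * (d - c) + c * (b - a)" by (simp add: algebra_simps)
      ultimately have "b * d - a * c < e" using he h(2) by (simp add: mult.commute)
      moreover have "a * c \<in> ?A" using True ab cd by (auto intro!: set_times_intro)
      ultimately show ?thesis using bd by blast
    next
      case False
      \<comment> \<open>A negative \<open>a\<close> or \<open>c\<close> gives no product in the
        lower component. But then b \<le> h or d \<le> h, so b * d itself is small, and the adjoined
        negative element -h / 2 serves as the lower partner.\<close>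
      have "b * d \<le> h * b0 + h * d0"
      proof (cases "a < 0")
        case True
        then have "b * d \<le> h * d0" using ab cd bd by (intro mult_mono) auto
        then show ?thesis using h(2) posX[OF b0(2)] by (simp add: add_increasing)
      next
        case a: False
        then have "d \<le> h" using False cd by linarith
        then have "b * d \<le> b0 * h" using ab cd bd by (intro mult_mono) auto
        then show ?thesis using h(2) posY[OF d0(2)] by (simp add: add_increasing2 mult.commute)
      qed
      then have "b * d - (- (h / 2)) < e" using he h(2) by simp
      moreover have "- (h / 2) \<in> ?A" using h by auto
      ultimately show ?thesis using bd by blast
    qed
  qed (use pcutD(1,2)[OF X(1)] pcutD(1,2)[OF Y(1)] in \<open>auto elim!: set_times_elim\<close>)
qed

lemma pnonneg_pprod: "pnonneg (pprod X Y)"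
  by (auto simp: pnonneg_def pprod_def cut_le_def rat_cut_def)

text \<open>Restricting the lower component of a product to nonnegative elements removes exactly the
  adjoined negative ones. What remains is associativity of elementwise products, so the identity
  holds for arbitrary pairs of sets.\<close>

lemma pprod_assoc:
  "pprod (pprod X Y) Z = pprod X (pprod Y Z)"
proof -
  have "{p \<in> {q \<in> S. q < 0} \<union> {a \<in> A. 0 \<le> a} * {c \<in> C. 0 \<le> c}. 0 \<le> p} =
      {a \<in> A. 0 \<le> a} * {c \<in> C. 0 \<le> c}" for A C
    by (auto elim!: set_times_elim)
  then show ?thesis by (simp add: pprod_def mult.assoc)
qed

lemma pprod_one:
  assumes X: "pcut X" "pnonneg X"
  shows "pprod (rat_cut 1) X = X"
proof -
  have one: "pcut (rat_cut 1)" "pnonneg (rat_cut 1)"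
    using pcut_rat_cut[OF one_S] by (auto simp: pnonneg_def cut_le_def rat_cut_def)
  have posX: "0 < b" if "b \<in> snd X" for b using that X pnonneg_iff by blast
  show ?thesis
  proof (rule pcut_eqI[OF pcut_pprod[OF one X] X(1)])
    fix s b assume "s \<in> fst (pprod (rat_cut 1) X)" and b: "b \<in> snd X"
    then consider "s < 0" | a c where "s = a * c" "a < 1" "c \<in> fst X" "0 \<le> a" "0 \<le> c"
      by (auto simp: pprod_def rat_cut_def elim!: set_times_elim)
    then show "s < b"
    proof cases
      case 1
      then show ?thesis using posX[OF b] by linarith
    next
      case 2
      then have "s \<le> c" by (simp add: mult_left_le_one_le)
      then show ?thesis using pcutD(5)[OF X(1) 2(3) b] by linarith
    qed
  next
    fix a s assume a: "a \<in> fst X" and "s \<in> snd (pprod (rat_cut 1) X)"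
    then obtain q b where s: "s = q * b" "1 < q" "b \<in> snd X" by (auto simp: pprod_def rat_cut_def elim!: set_times_elim)
    then have "b \<le> s" using posX[OF s(3)] by simp
    then show "a < s" using pcutD(5)[OF X(1) a s(3)] by linarith
  qed
qed

lemma pprod_zero:
  assumes X: "pcut X" "pnonneg X"
  shows "pprod (rat_cut 0) X = rat_cut 0"
proof -
  have zero: "pcut (rat_cut 0)" "pnonneg (rat_cut 0)"
    using pcut_rat_cut[OF zero_S] by (auto simp: pnonneg_def cut_le_def)
  show ?thesis
    by (rule pcut_eqI[OF pcut_pprod[OF zero X] zero(1)])
      (use X pnonneg_iff in \<open>auto simp: pprod_def rat_cut_def elim!: set_times_elim intro: less_trans[OF _ mult_pos_pos]\<close>)
qed

lemma pnonneg_psum: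
  assumes "pcut X" "pnonneg X" "pcut Y" "pnonneg Y"
  shows "pnonneg (psum X Y)"
  using assms by (auto simp: pnonneg_iff pcut_psum) (auto simp: psum_def intro!: add_pos_pos elim!: set_plus_elim)

text \<open>An upper element b * d + b' * f of the right side involves two different factors from
  \<open>X\<close> and need not have the form b * (d + f). The comparison criterion avoids merging
  them, because each term is bounded separately.\<close>

lemma pprod_psum:
  assumes X: "pcut X" "pnonneg X" and Y: "pcut Y" "pnonneg Y" and Z: "pcut Z" "pnonneg Z"
  shows "pprod X (psum Y Z) = psum (pprod X Y) (pprod X Z)"
proof -
  note YZ = pcut_psum[OF Y(1) Z(1)] pnonneg_psum[OF Y Z]
  note XY = pcut_pprod[OF X Y] and XZ = pcut_pprod[OF X Z]
  have pos: "0 < b" if "b \<in> snd X \<or> b \<in> snd Y \<or> b \<in> snd Z" for b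
    using that X Y Z pnonneg_iff by blast
  show ?thesis
  proof (rule pcut_eqI[OF pcut_pprod[OF X YZ] pcut_psum[OF XY XZ]])
    fix s t assume s: "s \<in> fst (pprod X (psum Y Z))" and "t \<in> snd (psum (pprod X Y) (pprod X Z))"
    then obtain b d b' f where t: "t = b * d + b' * f" "b \<in> snd X" "d \<in> snd Y" "b' \<in> snd X" "f \<in> snd Z"
      by (auto simp: psum_def pprod_def elim!: set_plus_elim set_times_elim)
    consider "s < 0" | a c e where "s = a * (c + e)" "a \<in> fst X" "c \<in> fst Y" "e \<in> fst Z" "0 \<le> a"
      using s by (auto simp: psum_def pprod_def elim!: set_plus_elim set_times_elim)
    then show "s < t"
    proof cases
      case 1
      then show ?thesis using t pos by (auto intro!: less_trans[OF _ add_pos_pos])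
    next
      case 2
      then show ?thesis
        using mult_less_of_pcut[OF X Y 2(2) t(2) 2(3) t(3)] mult_less_of_pcut[OF X Z 2(2) t(4) 2(4) t(5)]
        unfolding t(1) by (simp add: algebra_simps add_strict_mono)
    qed
  next
    fix s t assume "s \<in> fst (psum (pprod X Y) (pprod X Z))" and t: "t \<in> snd (pprod X (psum Y Z))"
    then obtain x y where s: "s = x + y" "x \<in> fst (pprod X Y)" "y \<in> fst (pprod X Z)"
      by (auto simp: psum_def elim!: set_plus_elim)
    from t obtain b d f where t: "t = b * (d + f)" "b \<in> snd X" "d \<in> snd Y" "f \<in> snd Z"
      by (auto simp: psum_def pprod_def elim!: set_plus_elim set_times_elim)
    have "x < b * d" using pcutD(5)[OF XY s(2)] t by (auto simp: pprod_def intro!: set_times_intro)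
    moreover have "y < b * f" using pcutD(5)[OF XZ s(3)] t by (auto simp: pprod_def intro!: set_times_intro)
    ultimately show "s < t" unfolding s(1) t(1) by (simp add: algebra_simps add_strict_mono)
  qed
qed

lemma pprod_inverse:
  assumes X: "pcut X" "pnonneg X" "X \<noteq> rat_cut 0"
  obtains Y where "pcut Y" "pnonneg Y" "pprod Y X = rat_cut 1"
proof -
  have posX: "0 < b" if "b \<in> snd X" for b using that X pnonneg_iff by blast
  have zero: "pcut (rat_cut 0)" using pcut_rat_cut zero_S by blast
  \<comment> \<open>A nonzero nonnegative cut has a positive lower element; without one the upper
    component of the inverse would be empty.\<close>
  have "\<not> cut_le X (rat_cut 0)" using pcut_antisym[OF X(1) zero] X by (auto simp: pnonneg_def)
  then obtain a0 b0 where "a0 \<in> fst X" "b0 \<in> snd (rat_cut 0)" "\<not> a0 < b0"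
    using pcut_le_iff[OF X(1) zero] by blast
  then have a0: "a0 \<in> fst X" "0 < a0" by (auto simp: rat_cut_def)
  obtain a1 b0 where b0: "b0 \<in> snd X" by (rule pcut_nonempty[OF X(1)])
  \<comment> \<open>Inversion exchanges the roles of the components. Elements below some inverse of
    an upper element include all nonpositive ones; the upper component uses positive lower elements
    only, since \<open>fst X\<close> also contains negative ones.\<close>
  define Y where "Y = ({x \<in> S. \<exists>b\<in>snd X. x \<le> inverse b}, {x \<in> S. \<exists>a\<in>fst X. 0 < a \<and> inverse a \<le> x})"
  have Y: "pcut Y"
    unfolding Y_def
  proof (rule pcutI)
    fix x assume "x \<in> {x \<in> S. \<exists>b\<in>snd X. x \<le> inverse b}"
    then obtain b where b: "b \<in> snd X" "x \<le> inverse b" by blast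
    obtain b' where b': "b' \<in> snd X" "b' < b" by (rule pcut_below[OF X(1) b(1)])
    have "x < inverse b'" using b less_imp_inverse_less[OF b'(2) posX[OF b'(1)]] by linarith
    moreover have "inverse b' \<in> S" using b' pcutD(2)[OF X(1)] by simp
    ultimately show "\<exists>x'\<in>{x \<in> S. \<exists>b\<in>snd X. x \<le> inverse b}. x < x'"
      using b' by blast
  next
    fix x assume "x \<in> {x \<in> S. \<exists>a\<in>fst X. 0 < a \<and> inverse a \<le> x}"
    then obtain a where a: "a \<in> fst X" "0 < a" "inverse a \<le> x" by blast
    obtain a' where a': "a' \<in> fst X" "a < a'" by (rule pcut_above[OF X(1) a(1)])
    have "inverse a' < x" using a less_imp_inverse_less[OF a'(2) a(2)] by linarith
    moreover have "inverse a' \<in> S" "0 < a'" using a a' pcutD(1)[OF X(1)] by auto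
    ultimately show "\<exists>x'\<in>{x \<in> S. \<exists>a\<in>fst X. 0 < a \<and> inverse a \<le> x}. x' < x"
      using a' by blast
  next
    fix x y assume "x \<in> {x \<in> S. \<exists>b\<in>snd X. x \<le> inverse b}"
      "y \<in> {x \<in> S. \<exists>a\<in>fst X. 0 < a \<and> inverse a \<le> x}"
    then obtain a b where "b \<in> snd X" "x \<le> inverse b" "a \<in> fst X" "0 < a" "inverse a \<le> y" by blast
    then show "x < y"
      using pcutD(5)[OF X(1)] less_imp_inverse_less[of a b] by fastforce
  next
    fix e :: 'u assume e: "e \<in> S" "0 < e"
    \<comment> \<open>The inverses differ by (b - a) / (a * b), and a * b \<ge> a0 * a0 once a0
      \<le> a < b. A pair closer than e * (a0 * a0) therefore has inverses closer than e.\<close>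
    have "e * (a0 * a0) \<in> S" using e a0 pcutD(1)[OF X(1)] by simp
    then obtain a b where ab: "a \<in> fst X" "b \<in> snd X" "b - a < e * (a0 * a0)" "a0 \<le> a"
      using e a0 by (elim pcut_tight_within[OF X(1) _ _ a0(1) b0]) auto
    have "a < b" using pcutD(5)[OF X(1)] ab by blast
    have "a0 * a0 \<le> a * b" using ab a0 \<open>a < b\<close> by (intro mult_mono) auto
    then have "e * (a0 * a0) \<le> e * (a * b)" using e by simp
    then have "b - a < e * (a * b)" using ab(3) by linarith
    moreover have "inverse a - inverse b = (b - a) / (a * b)" "0 < a * b"
      using a0 ab \<open>a < b\<close> by (auto simp: field_simps)
    ultimately have "inverse a - inverse b < e" by (simp add: divide_less_eq)
    moreover have "inverse a \<in> S" "inverse b \<in> S" using ab pcutD(1,2)[OF X(1)] by simp_all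
    moreover have "0 < a" using ab a0 by linarith
    ultimately show "\<exists>x\<in>{x \<in> S. \<exists>b\<in>snd X. x \<le> inverse b}.
        \<exists>y\<in>{x \<in> S. \<exists>a\<in>fst X. 0 < a \<and> inverse a \<le> x}. y - x < e"
      using ab by blast
  qed (auto intro: order_trans)
  have nn: "pnonneg Y"
    using pnonneg_iff[OF Y] by (auto simp: Y_def intro: less_le_trans[of 0 "inverse _"])
  have one: "pcut (rat_cut 1)" using pcut_rat_cut one_S by blast
  have "pprod Y X = rat_cut 1"
  proof (rule pcut_eqI[OF pcut_pprod[OF Y nn X(1,2)] one])
    fix s t assume s: "s \<in> fst (pprod Y X)" and t: "t \<in> snd (rat_cut 1)"
    consider "s < 0" | x b a where "s = x * a" "x \<le> inverse b" "b \<in> snd X" "a \<in> fst X" "0 \<le> x" "0 \<le> a"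
      using s by (auto simp: pprod_def Y_def elim!: set_times_elim)
    then have "s < 1"
    proof cases
      case 2
      then have "x * a \<le> inverse b * a" by (simp add: mult_right_mono)
      also have "\<dots> < 1" using posX 2 pcutD(5)[OF X(1)] by (simp add: field_simps)
      finally show ?thesis using 2 by simp
    qed simp
    then show "s < t" using t by (simp add: rat_cut_def)
  next
    fix s t assume s: "s \<in> fst (rat_cut 1)" and t: "t \<in> snd (pprod Y X)"
    then obtain x a b where t: "t = x * b" "inverse a \<le> x" "0 < a" "a \<in> fst X" "b \<in> snd X"
      by (auto simp: pprod_def Y_def elim!: set_times_elim)
    have "1 < inverse a * b" using t pcutD(5)[OF X(1)] by (simp add: field_simps)
    also have "\<dots> \<le> x * b" using t posX by (simp add: mult_right_mono)
    finally show "s < t" using s t by (simp add: rat_cut_def)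
  qed
  then show ?thesis using that Y nn by blast
qed

subsection \<open>Signed products\<close>

definition pabs :: "'u cut \<Rightarrow> 'u cut" where
  "pabs X = (if pnonneg X then X else pneg X)"

definition pmult :: "'u cut \<Rightarrow> 'u cut \<Rightarrow> 'u cut" where
  "pmult X Y = (let E = pprod (pabs X) (pabs Y) in if pnonneg X \<longleftrightarrow> pnonneg Y then E else pneg E)"

lemma pcut_zero: "pcut (rat_cut 0)" and pcut_one: "pcut (rat_cut 1)"
  by (simp_all add: pcut_rat_cut)

lemma pnonneg_zero: "pnonneg (rat_cut 0)" and pnonneg_one: "pnonneg (rat_cut 1)"
  by (auto simp: pnonneg_def cut_le_def rat_cut_def)

lemma pneg_zero: "pneg (rat_cut 0) = rat_cut 0"
  using psum_pneg[OF pcut_zero] psum_zero[OF pcut_pneg[OF pcut_zero]] by (simp add: psum_commute)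

lemma pnonneg_pneg:
  assumes X: "pcut X"
  shows "pnonneg (pneg X) \<longleftrightarrow> \<not> pnonneg X \<or> X = rat_cut 0"
proof -
  have "pnonneg (pneg X) \<longleftrightarrow> (\<forall>a\<in>fst X. a < 0)"
    using pnonneg_iff[OF pcut_pneg[OF X]] by (simp add: pneg_def)
  also have "\<dots> \<longleftrightarrow> cut_le X (rat_cut 0)"
    using pcutD(1)[OF X] by (auto simp: cut_le_def rat_cut_def)
  also have "\<dots> \<longleftrightarrow> \<not> pnonneg X \<or> X = rat_cut 0"
    using pcut_total[OF X pcut_zero] pcut_antisym[OF X pcut_zero] pnonneg_zero
    by (auto simp: pnonneg_def)
  finally show ?thesis .
qed

lemma pabs_pneg: "pcut X \<Longrightarrow> pabs (pneg X) = pabs X"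
  by (auto simp: pabs_def pnonneg_pneg pneg_zero)

lemma pcut_pabs: "pcut X \<Longrightarrow> pcut (pabs X)" and pnonneg_pabs: "pcut X \<Longrightarrow> pnonneg (pabs X)"
  by (auto simp: pabs_def pcut_pneg pnonneg_pneg)

lemma pcut_pmult: "pcut X \<Longrightarrow> pcut Y \<Longrightarrow> pcut (pmult X Y)"
  by (simp add: pmult_def Let_def pcut_pneg pcut_pprod pcut_pabs pnonneg_pabs)

lemma pmult_commute: "pmult X Y = pmult Y X"
  by (auto simp: pmult_def Let_def pprod_commute)

lemma pmult_nonneg: "pnonneg X \<Longrightarrow> pnonneg Y \<Longrightarrow> pmult X Y = pprod X Y"
  by (simp add: pmult_def pabs_def)

lemma pmult_zero: "pcut X \<Longrightarrow> pmult (rat_cut 0) X = rat_cut 0"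
  using pprod_zero[OF pcut_pabs pnonneg_pabs, of X]
  by (simp add: pmult_def Let_def pabs_def[of "rat_cut 0"] pnonneg_zero pneg_zero)

text \<open>Negation leaves \<open>pabs\<close> unchanged and flips the sign of every cut but zero,
  which is nonnegative together with its opposite and is treated apart.\<close>

lemma pmult_pneg_left:
  assumes X: "pcut X" and Y: "pcut Y"
  shows "pmult (pneg X) Y = pneg (pmult X Y)"
proof (cases "X = rat_cut 0")
  case True
  then show ?thesis by (simp add: pneg_zero pmult_zero Y)
next
  case False
  then show ?thesis by (simp add: pmult_def Let_def pabs_pneg[OF X] pnonneg_pneg[OF X])
qed

lemma pmult_pneg_right: "pcut X \<Longrightarrow> pcut Y \<Longrightarrow> pmult X (pneg Y) = pneg (pmult X Y)"
  using pmult_pneg_left[of Y X] by (simp add: pmult_commute)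

lemma pcut_sign_cases:
  assumes "pcut X"
  obtains (nonneg) "pnonneg X" | (neg) X' where "pcut X'" "pnonneg X'" "X = pneg X'"
  using assms pcut_pneg[OF assms] pnonneg_pneg[OF assms] pneg_pneg[of X] by metis

lemma pmult_assoc:
  assumes X: "pcut X" and Y: "pcut Y" and Z: "pcut Z"
  shows "pmult (pmult X Y) Z = pmult X (pmult Y Z)"
proof -
  \<comment> \<open>The sign restriction is lifted one argument at a time: from \<open>Z\<close>,
    then from \<open>Y\<close>, then from \<open>X\<close>.\<close>
  have nn: "pmult (pmult X Y) Z = pmult X (pmult Y Z)"
    if "pnonneg X" "pnonneg Y" "pnonneg Z" for X Y Z
    using that by (simp add: pmult_nonneg pnonneg_pprod pprod_assoc)
  note neg = pmult_pneg_left pmult_pneg_right pcut_pmult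
  have YZ: "pmult (pmult X Y) Z = pmult X (pmult Y Z)"
    if X: "pcut X" "pnonneg X" and Y: "pcut Y" "pnonneg Y" and Z: "pcut Z" for X Y Z
    using Z by (cases rule: pcut_sign_cases) (simp_all add: nn neg X Y Z)
  have nn': "pmult (pmult X Y) Z = pmult X (pmult Y Z)"
    if X: "pcut X" "pnonneg X" and Y: "pcut Y" and Z: "pcut Z" for X Y Z
    using Y by (cases rule: pcut_sign_cases) (simp_all add: YZ neg X Y Z)
  show ?thesis
    using X by (cases rule: pcut_sign_cases) (simp_all add: nn' neg X Y Z)
qed

lemma psum_pneg_cancel: "pcut X \<Longrightarrow> pcut Y \<Longrightarrow> psum (psum X (pneg Y)) Y = X"
  by (metis psum_assoc psum_commute psum_pneg psum_zero)

text \<open>If V = Y - Z is nonnegative, then Y = V + Z is a sum of nonnegative cuts and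
  \<open>pprod_psum\<close> applies. Otherwise Z - Y is nonnegative, and the identity with
  \<open>Y\<close> and \<open>Z\<close> exchanged is negated.\<close>

lemma pmult_diff:
  assumes X: "pcut X" "pnonneg X" and Y: "pcut Y" "pnonneg Y" and Z: "pcut Z" "pnonneg Z"
  shows "pmult X (psum Y (pneg Z)) = psum (pmult X Y) (pneg (pmult X Z))"
proof -
  have *: "pmult X (psum Y (pneg Z)) = psum (pmult X Y) (pneg (pmult X Z))"
    if Y: "pcut Y" "pnonneg Y" and Z: "pcut Z" "pnonneg Z" and V: "pnonneg (psum Y (pneg Z))" for Y Z
  proof -
    let ?V = "psum Y (pneg Z)"
    have V': "pcut ?V" using Y Z by (simp add: pcut_psum pcut_pneg)
    have "pmult X Y = psum (pmult X ?V) (pmult X Z)"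
      using pprod_psum[OF X V' V Z] psum_pneg_cancel[OF Y(1) Z(1)] X Y Z V
      by (simp add: pmult_nonneg)
    then show ?thesis
      using psum_pneg_cancel[of "pmult X ?V" "pneg (pmult X Z)"] X V' Z
      by (simp add: pcut_pmult pcut_pneg)
  qed
  have V: "pcut (psum Y (pneg Z))" using Y Z by (simp add: pcut_psum pcut_pneg)
  show ?thesis
  proof (cases "pnonneg (psum Y (pneg Z))")
    case True
    then show ?thesis using * Y Z by blast
  next
    case False
    have swap: "pneg (psum Y (pneg Z)) = psum Z (pneg Y)"
      by (simp add: pneg_psum psum_commute)
    then have "pnonneg (psum Z (pneg Y))" using False pnonneg_pneg[OF V] by simp
    then have "pneg (pmult X (psum Y (pneg Z))) = psum (pmult X Z) (pneg (pmult X Y))"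
      using *[OF Z Y] pmult_pneg_right[OF X(1) V] swap by simp
    then have "pmult X (psum Y (pneg Z)) = pneg (psum (pmult X Z) (pneg (pmult X Y)))"
      by (metis pneg_pneg)
    then show ?thesis by (simp add: pneg_psum psum_commute)
  qed
qed

text \<open>For nonnegative \<open>X\<close>, equal signs of \<open>Y\<close> and \<open>Z\<close>
  reduce to \<open>pprod_psum\<close> and opposite signs to \<open>pmult_diff\<close>; a negative
  \<open>X\<close> is then handled by negating both sides.\<close>

lemma pmult_psum:
  assumes X: "pcut X" and Y: "pcut Y" and Z: "pcut Z"
  shows "pmult X (psum Y Z) = psum (pmult X Y) (pmult X Z)"
proof -
  note neg = pmult_pneg_left pmult_pneg_right pcut_pmult pcut_psum
  have nn: "pmult X (psum Y Z) = psum (pmult X Y) (pmult X Z)"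
    if X: "pcut X" "pnonneg X" and Y: "pcut Y" and Z: "pcut Z" for X Y Z
    using Y
  proof (cases rule: pcut_sign_cases)
    case Y': nonneg
    show ?thesis
      using Z
    proof (cases rule: pcut_sign_cases)
      case nonneg
      then show ?thesis using X Y Y' Z by (simp add: pmult_nonneg pnonneg_psum pprod_psum)
    next
      case (neg Z')
      then show ?thesis using X Y Y' by (simp add: pmult_diff pmult_pneg_right)
    qed
  next
    case Y': (neg Y')
    show ?thesis
      using Z
    proof (cases rule: pcut_sign_cases)
      case nonneg
      then show ?thesis
        using pmult_diff[OF X Z nonneg Y'(1,2)] X Y' by (simp add: psum_commute pmult_pneg_right)
    next
      case Z': (neg Z')
      show ?thesis
        using X Y' Z' by (simp add: neg pmult_nonneg pnonneg_psum pprod_psum pneg_psum[symmetric])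
    qed
  qed
  show ?thesis
    using X by (cases rule: pcut_sign_cases) (simp_all add: nn neg pneg_psum X Y Z)
qed

lemma pmult_one:
  assumes X: "pcut X"
  shows "pmult (rat_cut 1) X = X"
  using X by (cases rule: pcut_sign_cases)
    (simp_all add: X pmult_pneg_right pmult_nonneg pnonneg_one pcut_one pprod_one)

lemma pmult_inverse:
  assumes X: "pcut X" "X \<noteq> rat_cut 0"
  obtains Y where "pcut Y" "pmult Y X = rat_cut 1"
  using X(1)
proof (cases rule: pcut_sign_cases)
  case nonneg
  then obtain Y where "pcut Y" "pnonneg Y" "pprod Y X = rat_cut 1"
    using pprod_inverse X by metis
  then show ?thesis using that nonneg by (simp add: pmult_nonneg)
next
  case (neg X')
  then have "X' \<noteq> rat_cut 0" using X pneg_zero by auto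
  then obtain Y where "pcut Y" "pnonneg Y" "pprod Y X' = rat_cut 1"
    using pprod_inverse neg by metis
  then show ?thesis
    using that[of "pneg Y"] neg by (simp add: pmult_nonneg pmult_pneg_left pmult_pneg_right pcut_pneg)
qed

section \<open>The linearly ordered field of proper cuts of a subfield\<close>

definition cut_oring :: "'u cut oring" where
  "cut_oring = \<lparr>carrier = {X. pcut X}, monoid.mult = pmult, one = rat_cut 1, zero = rat_cut 0,
     add = psum, rle = cut_le\<rparr>"

lemma linearly_ordered_field_cut_oring: "linearly_ordered_field cut_oring"
proof -
  have "abelian_group cut_oring"
  proof (rule abelian_groupI)
    fix X assume "X \<in> carrier cut_oring"
    then have "pneg X \<in> carrier cut_oring" "pneg X \<oplus>\<^bsub>cut_oring\<^esub> X = \<zero>\<^bsub>cut_oring\<^esub>"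
      by (simp_all add: cut_oring_def pcut_pneg psum_pneg)
    then show "\<exists>Y\<in>carrier cut_oring. Y \<oplus>\<^bsub>cut_oring\<^esub> X = \<zero>\<^bsub>cut_oring\<^esub>" by blast
  next
    fix X Y assume "X \<in> carrier cut_oring" "Y \<in> carrier cut_oring"
    show "X \<oplus>\<^bsub>cut_oring\<^esub> Y = Y \<oplus>\<^bsub>cut_oring\<^esub> X" by (simp add: cut_oring_def psum_commute)
  qed (simp_all add: cut_oring_def pcut_psum pcut_zero psum_assoc psum_zero)
  moreover have "comm_monoid cut_oring"
    by (rule comm_monoidI)
      (simp_all add: cut_oring_def pcut_pmult pcut_one pmult_assoc pmult_one, rule pmult_commute)
  ultimately interpret cring cut_oring
    by (rule cringI) (simp add: cut_oring_def pmult_psum pmult_commute[of "psum _ _"] pmult_commute)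
  have "field cut_oring"
  proof (rule cring_fieldI2)
    have "0 \<in> fst (rat_cut 1)" "0 \<notin> fst (rat_cut 0)" by (simp_all add: rat_cut_def)
    then show "\<zero>\<^bsub>cut_oring\<^esub> \<noteq> \<one>\<^bsub>cut_oring\<^esub>" by (auto simp: cut_oring_def)
  next
    fix X assume "X \<in> carrier cut_oring" "X \<noteq> \<zero>\<^bsub>cut_oring\<^esub>"
    then have X: "pcut X" "X \<noteq> rat_cut 0" by (simp_all add: cut_oring_def)
    then obtain Y where "pcut Y" "pmult Y X = rat_cut 1" by (rule pmult_inverse)
    then have "Y \<in> carrier cut_oring" "X \<otimes>\<^bsub>cut_oring\<^esub> Y = \<one>\<^bsub>cut_oring\<^esub>"
      by (simp_all add: cut_oring_def pmult_commute)
    then show "\<exists>Y\<in>carrier cut_oring. X \<otimes>\<^bsub>cut_oring\<^esub> Y = \<one>\<^bsub>cut_oring\<^esub>" by blast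
  qed
  moreover have "linear_order_on (carrier cut_oring)
      {(X, Y). X \<in> carrier cut_oring \<and> Y \<in> carrier cut_oring \<and> X \<preceq>\<^bsub>cut_oring\<^esub> Y}"
    unfolding order_on_defs
    by (intro conjI refl_onI transI antisymI total_onI)
      (use pcut_antisym pcut_total in \<open>auto simp: cut_oring_def cut_le_def\<close>)
  moreover have "pnonneg (pmult X Y)" if "pnonneg X" "pnonneg Y" for X Y
    using that by (simp add: pmult_nonneg pnonneg_pprod)
  ultimately show ?thesis
    unfolding linearly_ordered_field_def
    by (auto simp: cut_oring_def psum_mono pnonneg_def)
qed

end

section \<open>Transport of cuts\<close>

lemma linearly_ordered_field_transport:
  fixes R :: "'q oring" and S :: "'s oring"
  assumes R: "linearly_ordered_field R" and H: "H \<in> ring_iso R S"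
    and zero: "\<zero>\<^bsub>S\<^esub> = H \<zero>\<^bsub>R\<^esub>"
    and le: "\<And>x y. x \<in> carrier R \<Longrightarrow> y \<in> carrier R \<Longrightarrow> H x \<preceq>\<^bsub>S\<^esub> H y \<longleftrightarrow> x \<preceq>\<^bsub>R\<^esub> y"
  shows "linearly_ordered_field S"
proof -
  interpret R: field R using R by (simp add: linearly_ordered_field_def)
  \<comment> \<open>\<open>ring_iso\<close> does not mention zero, so the image is known to be a
    field only after its zero is overwritten by the image of zero; the assumption on
    \<open>S\<close> says that this changes nothing.\<close>
  have "field (S\<lparr>zero := H \<zero>\<^bsub>R\<^esub>\<rparr>)" by (rule R.ring_iso_imp_img_field[OF H])
  then have fld: "field S" by (simp add: zero[symmetric])
  have carr: "carrier S = H ` carrier R" and inj: "inj_on H (carrier R)"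
    using H by (auto simp: ring_iso_def bij_betw_def)
  have add: "H x \<oplus>\<^bsub>S\<^esub> H y = H (x \<oplus>\<^bsub>R\<^esub> y)" and mult: "H x \<otimes>\<^bsub>S\<^esub> H y = H (x \<otimes>\<^bsub>R\<^esub> y)"
    if "x \<in> carrier R" "y \<in> carrier R" for x y
    using ring_iso_memE(2,3)[OF H that] by simp_all
  let ?L = "{(x, y). x \<in> carrier R \<and> y \<in> carrier R \<and> x \<preceq>\<^bsub>R\<^esub> y}"
  have "linear_order_on (carrier R) ?L"
    using R by (simp add: linearly_ordered_field_def)
  then have L: "refl_on (carrier R) ?L" "total_on (carrier R) ?L" "antisym ?L" "trans ?L"
    by (simp_all add: order_on_defs)
  have refl: "x \<preceq>\<^bsub>R\<^esub> x" if "x \<in> carrier R" for x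
    using refl_onD[OF L(1) that] by simp
  have total: "x \<preceq>\<^bsub>R\<^esub> y" if "x \<in> carrier R" "y \<in> carrier R" "\<not> y \<preceq>\<^bsub>R\<^esub> x" for x y
    using L(2) that refl by (cases "x = y") (auto simp: total_on_def)
  have antisym: "x = y"
    if "x \<in> carrier R" "y \<in> carrier R" "x \<preceq>\<^bsub>R\<^esub> y" "y \<preceq>\<^bsub>R\<^esub> x" for x y
    using antisymD[OF L(3), of x y] that by simp
  have trans: "x \<preceq>\<^bsub>R\<^esub> z"
    if "x \<in> carrier R" "y \<in> carrier R" "z \<in> carrier R" "x \<preceq>\<^bsub>R\<^esub> y" "y \<preceq>\<^bsub>R\<^esub> z" for x y z
    using transD[OF L(4), of x y z] that by simp
  have "linear_order_on (carrier S) {(x, y). x \<in> carrier S \<and> y \<in> carrier S \<and> x \<preceq>\<^bsub>S\<^esub> y}"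
    unfolding order_on_defs
  proof (intro conjI refl_onI transI antisymI total_onI)
    fix x y z
    assume "(x, y) \<in> {(x, y). x \<in> carrier S \<and> y \<in> carrier S \<and> x \<preceq>\<^bsub>S\<^esub> y}"
      "(y, z) \<in> {(x, y). x \<in> carrier S \<and> y \<in> carrier S \<and> x \<preceq>\<^bsub>S\<^esub> y}"
    then show "(x, z) \<in> {(x, y). x \<in> carrier S \<and> y \<in> carrier S \<and> x \<preceq>\<^bsub>S\<^esub> y}"
      by (auto simp: carr le intro: trans)
  qed (auto simp: carr le refl intro: total dest: antisym)
  moreover have "\<forall>x\<in>carrier S. \<forall>y\<in>carrier S. \<forall>z\<in>carrier S.
      x \<preceq>\<^bsub>S\<^esub> y \<longrightarrow> x \<oplus>\<^bsub>S\<^esub> z \<preceq>\<^bsub>S\<^esub> y \<oplus>\<^bsub>S\<^esub> z"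
    using R by (auto simp: carr le add linearly_ordered_field_def)
  moreover have "\<forall>x\<in>carrier S. \<forall>y\<in>carrier S.
      \<zero>\<^bsub>S\<^esub> \<preceq>\<^bsub>S\<^esub> x \<and> \<zero>\<^bsub>S\<^esub> \<preceq>\<^bsub>S\<^esub> y \<longrightarrow> \<zero>\<^bsub>S\<^esub> \<preceq>\<^bsub>S\<^esub> x \<otimes>\<^bsub>S\<^esub> y"
    using R by (auto simp: carr le mult zero linearly_ordered_field_def)
  ultimately show ?thesis using fld by (simp add: linearly_ordered_field_def)
qed

section \<open>Cuts on a record as images of cuts on a subfield\<close>

locale subfield_iso = subring_iso S h F + ordered_subfield S
  for S :: "'u::linordered_field set" and h :: "'u \<Rightarrow> 'q" and F :: "'q oring"
begin

lemma lt_R: "u \<in> S \<Longrightarrow> v \<in> S \<Longrightarrow> h u \<prec>\<^bsub>F\<^esub> h v \<longleftrightarrow> u < v"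
  by (auto simp: le_R eq_iff)

lemma less_set_image:
  assumes "s \<in> S"
  shows "{q \<in> carrier F. q \<prec>\<^bsub>F\<^esub> h s} = h ` {q \<in> S. q < s}"
    and "{q \<in> carrier F. h s \<prec>\<^bsub>F\<^esub> q} = h ` {q \<in> S. s < q}"
  using assms by (auto simp: carrier_R le_R eq_iff order.strict_iff_order)

lemma mem_image: "u \<in> S \<Longrightarrow> A \<subseteq> S \<Longrightarrow> h u \<in> h ` A \<longleftrightarrow> u \<in> A"
  using inj_h by (rule inj_on_image_mem_iff)

lemma is_sup_image:
  assumes "A \<subseteq> S" "s \<in> S"
  shows "is_sup F (h ` A) (h s) \<longleftrightarrow>
    (\<forall>y\<in>A. y \<le> s) \<and> (\<forall>u\<in>S. (\<forall>y\<in>A. y \<le> u) \<longrightarrow> s \<le> u)"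
  using assms by (auto simp: is_sup_def carrier_R le_R subset_iff)

lemma is_inf_image:
  assumes "A \<subseteq> S" "s \<in> S"
  shows "is_inf F (h ` A) (h s) \<longleftrightarrow>
    (\<forall>y\<in>A. s \<le> y) \<and> (\<forall>u\<in>S. (\<forall>y\<in>A. u \<le> y) \<longrightarrow> u \<le> s)"
  using assms by (auto simp: is_inf_def carrier_R le_R subset_iff)

text \<open>An element of a set is its supremum exactly when it is the greatest element. The
  condition thus excludes a greatest element, whether or not a supremum exists.\<close>

lemma sup_notin_image:
  assumes A: "A \<subseteq> S"
  shows "(\<forall>s. is_sup F (h ` A) s \<longrightarrow> s \<notin> h ` A) \<longleftrightarrow> (\<forall>a\<in>A. \<exists>a'\<in>A. a < a')"
proof -
  have "(\<forall>s. is_sup F (h ` A) s \<longrightarrow> s \<notin> h ` A) \<longleftrightarrow> (\<forall>a\<in>A. \<not> is_sup F (h ` A) (h a))" by auto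
  also have "\<dots> \<longleftrightarrow> (\<forall>a\<in>A. \<exists>a'\<in>A. a < a')"
  proof (rule ball_cong[OF refl])
    fix a assume "a \<in> A"
    then show "\<not> is_sup F (h ` A) (h a) \<longleftrightarrow> (\<exists>a'\<in>A. a < a')"
      using is_sup_image[OF A, of a] A by (meson not_le subset_iff)
  qed
  finally show ?thesis .
qed

lemma inf_notin_image:
  assumes A: "A \<subseteq> S"
  shows "(\<forall>s. is_inf F (h ` A) s \<longrightarrow> s \<notin> h ` A) \<longleftrightarrow> (\<forall>a\<in>A. \<exists>a'\<in>A. a' < a)"
proof -
  have "(\<forall>s. is_inf F (h ` A) s \<longrightarrow> s \<notin> h ` A) \<longleftrightarrow> (\<forall>a\<in>A. \<not> is_inf F (h ` A) (h a))" by auto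
  also have "\<dots> \<longleftrightarrow> (\<forall>a\<in>A. \<exists>a'\<in>A. a' < a)"
  proof (rule ball_cong[OF refl])
    fix a assume "a \<in> A"
    then show "\<not> is_inf F (h ` A) (h a) \<longleftrightarrow> (\<exists>a'\<in>A. a' < a)"
      using is_inf_image[OF A, of a] A by (meson not_le subset_iff)
  qed
  finally show ?thesis .
qed

lemma is_cut_image:
  assumes A: "A \<subseteq> S" and B: "B \<subseteq> S"
  shows "is_cut F (h ` A, h ` B) \<longleftrightarrow>
    (\<forall>a\<in>A. \<forall>x\<in>S. x \<le> a \<longrightarrow> x \<in> A) \<and>
    (\<forall>b\<in>B. \<forall>x\<in>S. b \<le> x \<longrightarrow> x \<in> B) \<and>
    (\<forall>a\<in>A. \<forall>b\<in>B. a < b) \<and>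
    (\<forall>x\<in>S - (A \<union> B). \<forall>y\<in>S - (A \<union> B). x = y) \<and>
    (\<forall>b\<in>B. \<exists>b'\<in>B. b' < b) \<and> (\<forall>a\<in>A. \<exists>a'\<in>A. a < a')"
proof -
  have AB: "x \<in> S" if "x \<in> A \<or> x \<in> B" for x using that A B by blast
  have "carrier F - (h ` A \<union> h ` B) = h ` (S - (A \<union> B))"
    using inj_on_image_set_diff[OF inj_h, of S "A \<union> B"] A B by (simp add: carrier_R image_Un)
  then have compl: "(\<forall>x\<in>carrier F - (h ` A \<union> h ` B). \<forall>y\<in>carrier F - (h ` A \<union> h ` B). x = y) \<longleftrightarrow>
      (\<forall>x\<in>S - (A \<union> B). \<forall>y\<in>S - (A \<union> B). x = y)"
    using eq_iff by auto
  have sub: "h ` A \<subseteq> carrier F" "h ` B \<subseteq> carrier F" using A B by (auto simp: carrier_R)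
  have lower: "(\<forall>a\<in>h ` A. \<forall>x\<in>carrier F. x \<preceq>\<^bsub>F\<^esub> a \<longrightarrow> x \<in> h ` A) \<longleftrightarrow>
      (\<forall>a\<in>A. \<forall>x\<in>S. x \<le> a \<longrightarrow> x \<in> A)"
    by (simp add: carrier_R le_R AB mem_image[OF _ A])
  have upper: "(\<forall>b\<in>h ` B. \<forall>x\<in>carrier F. b \<preceq>\<^bsub>F\<^esub> x \<longrightarrow> x \<in> h ` B) \<longleftrightarrow>
      (\<forall>b\<in>B. \<forall>x\<in>S. b \<le> x \<longrightarrow> x \<in> B)"
    by (simp add: carrier_R le_R AB mem_image[OF _ B])
  have cross: "(\<forall>a\<in>h ` A. \<forall>b\<in>h ` B. a \<prec>\<^bsub>F\<^esub> b) \<longleftrightarrow> (\<forall>a\<in>A. \<forall>b\<in>B. a < b)"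
    using lt_R AB by simp
  have disj: "h ` A \<inter> h ` B = {}" if "\<forall>a\<in>A. \<forall>b\<in>B. a < b"
  proof -
    have "h a \<noteq> h b" if "a \<in> A" "b \<in> B" for a b
      using that \<open>\<forall>a\<in>A. \<forall>b\<in>B. a < b\<close> eq_iff[of a b] AB by fastforce
    then show ?thesis by auto
  qed
  show ?thesis
    unfolding is_cut_def prod.case compl lower upper cross sup_notin_image[OF A] inf_notin_image[OF B]
    by (rule iffI; elim conjE; intro conjI; (assumption | rule sub | (rule disj, assumption)))
qed

lemma rball_image:
  assumes "x \<in> S" "r \<in> S"
  shows "rball F (h x) (h r) = h ` {y \<in> S. \<bar>x - y\<bar> < r}"
proof -
  have abs_S: "\<bar>u\<bar> \<in> S" if "u \<in> S" for u using that by (simp add: abs_if)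
  have "rabs F (h u) = h \<bar>u\<bar>" if "u \<in> S" for u
    using that by (auto simp: rabs_def zero_R le_R uminus_R)
  then have "rabs F (h x \<ominus>\<^bsub>F\<^esub> h y) \<prec>\<^bsub>F\<^esub> h r \<longleftrightarrow> \<bar>x - y\<bar> < r" if "y \<in> S" for y
    using that assms lt_R by (simp add: minus_R abs_S)
  then show ?thesis by (auto simp: rball_def carrier_R)
qed

text \<open>An upper bound u below x + r is at least the centre x, so the midpoint of u and x + r
  still lies in the ball and exceeds u. With the dual fact for infima, the diameter of a ball is
  twice its radius.\<close>

lemma sup_rball:
  assumes x: "x \<in> S" and r: "r \<in> S" "0 < r"
  shows "(THE s. is_sup F (rball F (h x) (h r)) s) = h (x + r)"
proof (rule the_equality)
  let ?U = "{y \<in> S. \<bar>x - y\<bar> < r}"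
  have U: "?U \<subseteq> S" by auto
  have le: "x + r \<le> u" if u: "u \<in> S" "\<forall>y\<in>?U. y \<le> u" for u
  proof (rule ccontr)
    assume "\<not> x + r \<le> u"
    moreover have "x \<le> u" using u x r by simp
    ultimately have "(u + (x + r)) / 2 \<in> ?U" "u < (u + (x + r)) / 2"
      using u x r by (auto simp: abs_less_iff field_simps)
    then show False using u(2) by force
  qed
  then show *: "is_sup F (rball F (h x) (h r)) (h (x + r))"
    using x r is_sup_image[OF U, of "x + r"] unfolding rball_image[OF x r(1)]
    by (auto simp: abs_less_iff)
  fix s assume s: "is_sup F (rball F (h x) (h r)) s"
  then obtain t where t: "t \<in> S" "s = h t" by (auto simp: is_sup_def carrier_R)
  have "h t \<preceq>\<^bsub>F\<^esub> h (x + r)" "h (x + r) \<preceq>\<^bsub>F\<^esub> h t"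
    using * s unfolding t(2) is_sup_def by blast+
  then show "s = h (x + r)" using t x r by (simp add: le_R)
qed

lemma inf_rball:
  assumes x: "x \<in> S" and r: "r \<in> S" "0 < r"
  shows "(THE s. is_inf F (rball F (h x) (h r)) s) = h (x - r)"
proof (rule the_equality)
  let ?U = "{y \<in> S. \<bar>x - y\<bar> < r}"
  have U: "?U \<subseteq> S" by auto
  have le: "u \<le> x - r" if u: "u \<in> S" "\<forall>y\<in>?U. u \<le> y" for u
  proof (rule ccontr)
    assume "\<not> u \<le> x - r"
    moreover have "u \<le> x" using u x r by simp
    ultimately have "(u + (x - r)) / 2 \<in> ?U" "(u + (x - r)) / 2 < u"
      using u x r by (auto simp: abs_less_iff field_simps)
    then show False using u(2) by force
  qed
  then show *: "is_inf F (rball F (h x) (h r)) (h (x - r))"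
    using x r is_inf_image[OF U, of "x - r"] unfolding rball_image[OF x r(1)]
    by (auto simp: abs_less_iff)
  fix s assume s: "is_inf F (rball F (h x) (h r)) s"
  then obtain t where t: "t \<in> S" "s = h t" by (auto simp: is_inf_def carrier_R)
  have "h t \<preceq>\<^bsub>F\<^esub> h (x - r)" "h (x - r) \<preceq>\<^bsub>F\<^esub> h t"
    using * s unfolding t(2) is_inf_def by blast+
  then show "s = h (x - r)" using t x r by (simp add: le_R)
qed

lemma improper_image:
  assumes A: "A \<subseteq> S" and B: "B \<subseteq> S"
  shows "improper F (h ` A, h ` B) \<longleftrightarrow> (\<exists>d\<in>S. 0 < d \<and>
    (\<forall>x\<in>S. \<forall>r\<in>S. 0 < r \<longrightarrow> (\<exists>a\<in>A. \<bar>x - a\<bar> < r) \<longrightarrow> (\<exists>b\<in>B. \<bar>x - b\<bar> < r) \<longrightarrow> d < 2 * r))"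
proof -
  have meets: "rball F (h x) (h r) \<inter> h ` C \<noteq> {} \<longleftrightarrow> (\<exists>a\<in>C. \<bar>x - a\<bar> < r)"
    if "C \<subseteq> S" "x \<in> S" "r \<in> S" for C x r
  proof -
    have "rball F (h x) (h r) \<inter> h ` C = h ` ({y \<in> S. \<bar>x - y\<bar> < r} \<inter> C)"
      using inj_on_image_Int[OF inj_h, of "{y \<in> S. \<bar>x - y\<bar> < r}" C] that
      by (simp add: rball_image)
    then show ?thesis using that by auto
  qed
  have diam: "h d \<prec>\<^bsub>F\<^esub> (THE s. is_sup F (rball F (h x) (h r)) s)
      \<ominus>\<^bsub>F\<^esub> (THE s. is_inf F (rball F (h x) (h r)) s) \<longleftrightarrow> d < 2 * r"
    if "d \<in> S" "x \<in> S" "r \<in> S" "0 < r" for d x r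
  proof -
    have "x + r - (x - r) = 2 * r" by simp
    then show ?thesis using that by (simp add: sup_rball inf_rball minus_R lt_R del: minus_diff_eq)
  qed
  have pos: "\<zero>\<^bsub>F\<^esub> \<prec>\<^bsub>F\<^esub> h d \<longleftrightarrow> 0 < d" if "d \<in> S" for d
    using lt_R[OF zero_S that] by (simp add: zero_R)
  have inner: "(\<zero>\<^bsub>F\<^esub> \<prec>\<^bsub>F\<^esub> h r \<longrightarrow>
        rball F (h x) (h r) \<inter> h ` A \<noteq> {} \<and> rball F (h x) (h r) \<inter> h ` B \<noteq> {} \<longrightarrow>
        h d \<prec>\<^bsub>F\<^esub> (THE s. is_sup F (rball F (h x) (h r)) s)
          \<ominus>\<^bsub>F\<^esub> (THE s. is_inf F (rball F (h x) (h r)) s)) \<longleftrightarrow>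
      (0 < r \<longrightarrow> (\<exists>a\<in>A. \<bar>x - a\<bar> < r) \<longrightarrow> (\<exists>b\<in>B. \<bar>x - b\<bar> < r) \<longrightarrow> d < 2 * r)"
    if "d \<in> S" "x \<in> S" "r \<in> S" for d x r
    unfolding meets[OF A that(2,3)] meets[OF B that(2,3)] pos[OF that(3)] using diam[OF that] by blast
  show ?thesis
    unfolding improper_def prod.case Let_def carrier_R bex_simps(7) ball_simps(9)
    by (intro bex_cong ball_cong refl conj_cong pos inner)
qed

definition cut_image :: "'u cut \<Rightarrow> 'q cut" where
  "cut_image X = (h ` fst X, h ` snd X)"

text \<open>A ball meeting both components with diameter at most d yields a pair with b - a < d, and
  the ball of radius d / 2 about the midpoint of such a pair gives the converse.\<close>

lemma pcut_iff:
  assumes X: "fst X \<subseteq> S" "snd X \<subseteq> S"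
  shows "pcut X \<longleftrightarrow> is_cut F (cut_image X) \<and> \<not> improper F (cut_image X)"
proof
  assume P: "pcut X"
  \<comment> \<open>Of two omitted points x < y, both would lie strictly between the members of any
    pair of lower and upper elements, which contradicts a pair closer than y - x.\<close>
  have "x = y" if "x \<in> S - (fst X \<union> snd X)" "y \<in> S - (fst X \<union> snd X)" for x y
  proof -
    have "\<not> x < y" if xy: "x \<in> S - (fst X \<union> snd X)" "y \<in> S - (fst X \<union> snd X)" for x y
    proof
      assume "x < y"
      then have "y - x \<in> S" "0 < y - x" using xy by auto
      then obtain a b where ab: "a \<in> fst X" "b \<in> snd X" "b - a < y - x"
        by (rule pcut_tight[OF P])
      have "a < x" using pcutD(3)[OF P ab(1), of x] xy by (meson DiffD1 DiffD2 UnI1 not_le)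
      moreover have "y < b" using pcutD(4)[OF P ab(2), of y] xy by (meson DiffD1 DiffD2 UnI2 not_le)
      ultimately show False using ab(3) by linarith
    qed
    then show ?thesis using that by (meson linorder_neqE)
  qed
  then have "is_cut F (cut_image X)"
    using P unfolding cut_image_def is_cut_image[OF X] pcut_def by blast
  moreover have "\<not> improper F (cut_image X)"
    unfolding cut_image_def improper_image[OF X]
  proof (rule notI, elim bexE conjE)
    fix d assume d: "d \<in> S" "0 < d"
      and wide: "\<forall>x\<in>S. \<forall>r\<in>S. 0 < r \<longrightarrow> (\<exists>a\<in>fst X. \<bar>x - a\<bar> < r) \<longrightarrow> (\<exists>b\<in>snd X. \<bar>x - b\<bar> < r) \<longrightarrow> d < 2 * r"
    obtain a b where ab: "a \<in> fst X" "b \<in> snd X" "b - a < d" by (rule pcut_tight[OF P d])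
    have "a < b" using pcutD(5)[OF P] ab by blast
    define x where "x = (a + b) / 2"
    have "a \<in> S" "b \<in> S" using ab X by blast+
    then have "x \<in> S" by (simp add: x_def)
    moreover have "\<bar>x - a\<bar> < d / 2" "\<bar>x - b\<bar> < d / 2"
      using ab \<open>a < b\<close> by (auto simp: x_def abs_less_iff field_simps)
    moreover have "d / 2 \<in> S" "0 < d / 2" using d by simp_all
    ultimately have "d < 2 * (d / 2)" using wide ab by blast
    then show False by simp
  qed
  ultimately show "is_cut F (cut_image X) \<and> \<not> improper F (cut_image X)" ..
next
  assume P: "is_cut F (cut_image X) \<and> \<not> improper F (cut_image X)"
  have "\<exists>a\<in>fst X. \<exists>b\<in>snd X. b - a < d" if d: "d \<in> S" "0 < d" for d
  proof -
    have "\<not> improper F (h ` fst X, h ` snd X)" using P by (simp add: cut_image_def)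
    \<comment> \<open>Two points of a ball of radius r are less than 2 * r apart, and here 2 * r
      \<le> d.\<close>
    then obtain x r a b where "a \<in> fst X" "b \<in> snd X" "\<bar>x - a\<bar> < r" "\<bar>x - b\<bar> < r" "\<not> d < 2 * r"
      using d unfolding improper_image[OF X] by blast
    moreover from this have "b - a < d" by (simp add: abs_less_iff)
    ultimately show ?thesis by blast
  qed
  then show "pcut X"
    using P X unfolding cut_image_def is_cut_image[OF X] pcut_def by blast
qed

section \<open>Compatibility of \<open>cut_image\<close> with operations and order\<close>

lemma cut_image_psum:
  assumes "pcut X" "pcut Y"
  shows "cut_add F (cut_image X) (cut_image Y) = cut_image (psum X Y)"
proof -
  have "h ` A <+>\<^bsub>F\<^esub> h ` C = h ` (A + C)" if A: "A \<subseteq> S" and C: "C \<subseteq> S" for A C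
  proof -
    have "h a \<oplus>\<^bsub>F\<^esub> h c = h (a + c)" if "a \<in> A" "c \<in> C" for a c
      using that A C by (intro add_R) auto
    then show ?thesis by (force simp: set_add_def' set_plus_def)
  qed
  then show ?thesis
    using assms by (simp add: cut_add_def cut_image_def psum_def pcut_def)
qed

lemma cut_image_pneg:
  assumes "pcut X"
  shows "cut_uminus F (cut_image X) = cut_image (pneg X)"
proof -
  have "(\<lambda>y. \<ominus>\<^bsub>F\<^esub> y) ` h ` A = h ` uminus ` A" if "A \<subseteq> S" for A
    unfolding image_image by (rule image_cong[OF refl]) (use that uminus_R in auto)
  then show ?thesis
    using assms by (simp add: cut_uminus_def cut_image_def pneg_def pcut_def)
qed

lemma cut_le_image:
  assumes "pcut X" "pcut Y"
  shows "cut_le (cut_image X) (cut_image Y) \<longleftrightarrow> cut_le X Y"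
proof -
  have "fst X \<subseteq> S" "fst Y \<subseteq> S" using assms by (simp_all add: pcut_def)
  then have "(\<forall>a\<in>fst X. h a \<in> h ` fst Y) \<longleftrightarrow> (\<forall>a\<in>fst X. a \<in> fst Y)"
    by (intro ball_cong refl mem_image) auto
  then show ?thesis by (simp add: cut_le_def cut_image_def image_subset_iff subset_eq)
qed

lemma cut_image_zero: "cut_zero F = cut_image (rat_cut 0)"
  by (simp add: cut_zero_def cut_image_def rat_cut_def zero_R less_set_image)

lemma cut_image_one: "cut_one F = cut_image (rat_cut 1)"
  by (simp add: cut_one_def cut_image_def rat_cut_def one_R less_set_image)

lemma cut_nonneg_image: "pcut X \<Longrightarrow> cut_nonneg F (cut_image X) \<longleftrightarrow> pnonneg X"
  by (simp add: cut_nonneg_def pnonneg_def cut_image_zero cut_le_image pcut_zero)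

lemma cut_image_pabs: "pcut X \<Longrightarrow> cut_abs F (cut_image X) = cut_image (pabs X)"
  by (simp add: cut_abs_def pabs_def cut_nonneg_image cut_image_pneg)

lemma cut_image_pprod:
  assumes X: "pcut X" and Y: "pcut Y"
  shows "cut_mult_nonneg F (cut_image X) (cut_image Y) = cut_image (pprod X Y)"
proof -
  have mult: "h ` A <#>\<^bsub>F\<^esub> h ` C = h ` (A * C)" if A: "A \<subseteq> S" and C: "C \<subseteq> S" for A C
  proof -
    have "h a \<otimes>\<^bsub>F\<^esub> h c = h (a * c)" if "a \<in> A" "c \<in> C" for a c
      using that A C by (intro mult_R) auto
    then show ?thesis by (force simp: set_mult_def set_times_def)
  qed
  have "{x \<in> h ` A. \<zero>\<^bsub>F\<^esub> \<preceq>\<^bsub>F\<^esub> x} = h ` {a \<in> A. 0 \<le> a}" if "A \<subseteq> S" for A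
    using that le_R[OF zero_S] by (auto simp: zero_R subset_iff)
  moreover have "{q \<in> carrier F. q \<prec>\<^bsub>F\<^esub> \<zero>\<^bsub>F\<^esub>} = h ` {q \<in> S. q < 0}"
    by (simp add: zero_R less_set_image)
  moreover have "fst X \<subseteq> S" "snd X \<subseteq> S" "fst Y \<subseteq> S" "snd Y \<subseteq> S"
    using X Y by (auto simp: pcut_def)
  moreover from this have "{a \<in> fst X. 0 \<le> a} \<subseteq> S" "{a \<in> fst Y. 0 \<le> a} \<subseteq> S" by auto
  ultimately show ?thesis
    by (simp add: cut_mult_nonneg_def cut_image_def pprod_def mult image_Un)
qed

lemma cut_image_pmult:
  assumes "pcut X" "pcut Y"
  shows "cut_mult F (cut_image X) (cut_image Y) = cut_image (pmult X Y)"
  using assms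
  by (simp add: cut_mult_def pmult_def Let_def cut_nonneg_image cut_image_pabs cut_image_pprod
      cut_image_pneg pcut_pabs pcut_pprod pnonneg_pabs)

lemma cut_image_ring_iso: "cut_image \<in> ring_iso cut_oring (proper_cuts F)"
proof (rule ring_iso_memI)
  have inj: "inj_on cut_image {X. pcut X}"
  proof (rule inj_onI)
    fix X Y assume "X \<in> {X. pcut X}" "Y \<in> {X. pcut X}" and eq: "cut_image X = cut_image Y"
    then have XY: "pcut X" "pcut Y" by simp_all
    have "cut_le X Y" "cut_le Y X"
      using cut_le_image[OF XY] cut_le_image[OF XY(2,1)] unfolding eq by (simp_all add: cut_le_def)
    then show "X = Y" by (rule pcut_antisym[OF XY])
  qed
  have "cut_image ` {X. pcut X} = {c. is_cut F c \<and> \<not> improper F c}"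
  proof (intro equalityI subsetI)
    fix c assume "c \<in> cut_image ` {X. pcut X}"
    then obtain X where "pcut X" "c = cut_image X" by blast
    then show "c \<in> {c. is_cut F c \<and> \<not> improper F c}"
      using pcut_iff[of X] by (simp add: pcut_def)
  next
    fix c assume c: "c \<in> {c. is_cut F c \<and> \<not> improper F c}"
    then have "fst c \<subseteq> h ` S" "snd c \<subseteq> h ` S" by (auto simp: is_cut_def carrier_R)
    then obtain A B where AB: "A \<subseteq> S" "B \<subseteq> S" "fst c = h ` A" "snd c = h ` B"
      by (auto elim!: subset_imageE)
    then have "c = cut_image (A, B)" by (simp add: cut_image_def prod_eq_iff)
    then show "c \<in> cut_image ` {X. pcut X}" using c AB pcut_iff[of "(A, B)"] by auto
  qed
  with inj show "bij_betw cut_image (carrier cut_oring) (carrier (proper_cuts F))"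
    by (simp add: bij_betw_def cut_oring_def proper_cuts_def)
  then show "cut_image X \<in> carrier (proper_cuts F)" if "X \<in> carrier cut_oring" for X
    using that by (auto simp: bij_betw_def)
qed (auto simp: cut_oring_def proper_cuts_def cut_image_pmult cut_image_psum cut_image_one)

lemma linearly_ordered_field_proper_cuts: "linearly_ordered_field (proper_cuts F)"
  by (rule linearly_ordered_field_transport[OF linearly_ordered_field_cut_oring cut_image_ring_iso])
    (simp_all add: cut_oring_def proper_cuts_def cut_image_zero cut_le_image)

end

theorem mainTheorem10:
  fixes \<alpha> :: "'a rel"
  assumes "Well_order \<alpha>"
  shows "linearly_ordered_field (R_field \<alpha>)"
proof -
  interpret Z: subring_iso "Z_dom \<alpha>" "Z_class \<alpha>" "Z_ring \<alpha>"
    by (rule subring_iso_Z[OF assms])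
  interpret Q: subring_iso Z.fracs Z.frac_class "frac_field (Z_ring \<alpha>)"
    by (rule Z.subring_iso_frac_field)
  interpret subfield_iso Z.fracs Z.frac_class "frac_field (Z_ring \<alpha>)"
    by unfold_locales
      (simp_all add: Q.zero_D Q.one_D Q.add_D Q.uminus_D Q.mult_D Z.inverse_fracs)
  show ?thesis
    unfolding R_field_def Q_field_def by (rule linearly_ordered_field_proper_cuts)
qed

end
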